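(* Let $k$ be an algebraically closed field, $A$ a finitely generated commutative normal $k$-algebra and $G$ a connected algebraic group acting rationally on $A$. Let $H$ be the affine coordinate ring of $G$, and let $\chi(G)$ be the group of characters of $G$. Then $$G(A\otimes H)=\{1\otimes\phi\mid \phi\in G(H)=\chi(G)\}.$$
   Context: A commutative algebra which is an integral domain is called normal if it is integrally closed in its field of fractions; so $A$ is an integral domain. $G$ is an affine algebraic group over $k$ acting rationally on $A$ by $k$-algebra automorphisms; thus $A$ is a right $H$-comodule algebra with coaction $a\mapsto a_{[0]}\otimes a_{[1]}\in A\otimes H$ determined by $g.a=a_{[0]}\,a_{[1]}(g)$ for $g\in G$. $H$ is a commutative Hopf algebra with comultiplication $\Delta(f)=f_{(1)}\otimes f_{(2)}$, $f(gg')=f_{(1)}(g)f_{(2)}(g')$, and counit $\varepsilon(f)=f(1_G)$. $G(H)=\{f\in H\mid \Delta(f)=f\otimes f,\ \varepsilon(f)=1\}$ is the set of grouplike elements of $H$, which coincides with the group $\chi(G)$ of characters (morphisms of algebraic groups $G\to k^*$) viewed as elements of $H$. $G(A\otimes H)$ is the set of grouplike elements of the $A$-coring $A\otimes H$, i.e. of elements $\sum_i a_i\otimes f_i\in A\otimes H$ with $$\sum_i a_i\otimes f_{i(1)}\otimes f_{i(2)}=\sum_{i,j}a_i a_{j[0]}\otimes f_i a_{j[1]}\otimes f_j\quad\text{and}\quad \sum_i a_i\varepsilon(f_i)=1.$$ *)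

theory Defs
  imports
    "HOL-Analysis.Analysis"
    "HOL-Algebra.Free_Abelian_Groups"
    "HOL-Algebra.Group_Action"
    "HOL-Computational_Algebra.Polynomial_Factorial"
    "HOL-Library.Function_Algebras"
begin

section \<open>Commutative algebras\<close>

locale k_algebra = vector_space smul
  for smul :: "'k::field \<Rightarrow> 'a::comm_ring_1 \<Rightarrow> 'a" +
  assumes scale_mult_left: "smul c x * y = smul c (x * y)"

inductive_set subalgebra_generated ::
    "('k::field \<Rightarrow> 'a::comm_ring_1 \<Rightarrow> 'a) \<Rightarrow> 'a set \<Rightarrow> 'a set"
  for smul :: "'k \<Rightarrow> 'a \<Rightarrow> 'a" and S :: "'a set" where
  generator: "x \<in> S \<Longrightarrow> x \<in> subalgebra_generated smul S"
| scalar: "smul c 1 \<in> subalgebra_generated smul S"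
| add: "x \<in> subalgebra_generated smul S \<Longrightarrow> y \<in> subalgebra_generated smul S
    \<Longrightarrow> x + y \<in> subalgebra_generated smul S"
| mult: "x \<in> subalgebra_generated smul S \<Longrightarrow> y \<in> subalgebra_generated smul S
    \<Longrightarrow> x * y \<in> subalgebra_generated smul S"

definition finitely_generated_algebra ::
    "('k::field \<Rightarrow> 'a::comm_ring_1 \<Rightarrow> 'a) \<Rightarrow> bool" where
  "finitely_generated_algebra smul \<longleftrightarrow>
     (\<exists>S. finite S \<and> subalgebra_generated smul S = UNIV)"

definition integral_over_ring :: "'a::idom fract \<Rightarrow> bool" where
  "integral_over_ring x \<longleftrightarrow>
     (\<exists>p :: 'a poly. lead_coeff p = 1 \<and> poly (map_poly to_fract p) x = 0)"

definition normal_domain :: "'a::idom itself \<Rightarrow> bool" where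
  "normal_domain _ \<longleftrightarrow>
     (\<forall>x :: 'a fract. integral_over_ring x \<longrightarrow> x \<in> range to_fract)"


section \<open>Affine varieties\<close>

definition fun_scale :: "'k::times \<Rightarrow> ('x \<Rightarrow> 'k) \<Rightarrow> 'x \<Rightarrow> 'k" where
  "fun_scale c f = (\<lambda>x. c * f x)"

definition polynomial_functions :: "(('k::field) ^ 'n \<Rightarrow> 'k) set" where
  "polynomial_functions = subalgebra_generated fun_scale (range (\<lambda>i x. x $ i))"

definition zariski_closed :: "(('k::field) ^ 'n) set \<Rightarrow> bool" where
  "zariski_closed X \<longleftrightarrow> (\<exists>P \<subseteq> polynomial_functions. X = {x. \<forall>p\<in>P. p x = 0})"

text \<open>The coordinate ring \<open>k[X]\<close>. A regular function on \<open>X\<close> is extended by zero outside \<open>X\<close>,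
  so that equality of regular functions is equality in HOL and the ring operations are the
  pointwise ones; the unit of \<open>k[X]\<close> is the indicator function of \<open>X\<close>.\<close>

definition coordinate_ring :: "(('k::field) ^ 'n) set \<Rightarrow> ('k ^ 'n \<Rightarrow> 'k) set" where
  "coordinate_ring X = {\<lambda>x. if x \<in> X then p x else 0 | p. p \<in> polynomial_functions}"

text \<open>The principal open sets \<open>{x \<in> X. f x \<noteq> 0}\<close> form a basis of the Zariski topology.\<close>

definition zariski_topology :: "(('k::field) ^ 'n) set \<Rightarrow> ('k ^ 'n) topology" where
  "zariski_topology X =
     topology_generated_by {{x \<in> X. f x \<noteq> 0} | f. f \<in> coordinate_ring X}"

definition morphism ::
    "(('k::field) ^ 'm) set \<Rightarrow> ('k ^ 'n) set \<Rightarrow> ('k ^ 'm \<Rightarrow> 'k ^ 'n) \<Rightarrow> bool" where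
  "morphism X Y \<phi> \<longleftrightarrow>
     \<phi> \<in> X \<rightarrow> Y \<and> (\<forall>i. \<exists>p\<in>polynomial_functions. \<forall>x\<in>X. \<phi> x $ i = p x)"

definition left_part :: "'k ^ ('m::finite + 'n::finite) \<Rightarrow> 'k ^ 'm" where
  "left_part z = (\<chi> i. z $ Inl i)"

definition right_part :: "'k ^ ('m::finite + 'n::finite) \<Rightarrow> 'k ^ 'n" where
  "right_part z = (\<chi> i. z $ Inr i)"

definition product_variety ::
    "('k ^ 'm) set \<Rightarrow> ('k ^ 'n) set \<Rightarrow> ('k ^ ('m::finite + 'n::finite)) set" where
  "product_variety X Y = {z. left_part z \<in> X \<and> right_part z \<in> Y}"


section \<open>Affine algebraic groups and rational actions\<close>

locale affine_algebraic_group = group G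
  for G :: "(('k::alg_closed_field) ^ 'n) monoid" (structure) +
  assumes closed: "zariski_closed (carrier G)"
    and mult_morphism:
      "morphism (product_variety (carrier G) (carrier G)) (carrier G)
         (\<lambda>z. left_part z \<otimes> right_part z)"
    and inv_morphism: "morphism (carrier G) (carrier G) (\<lambda>x. inv x)"

definition multiplicative_group :: "('k::field) monoid" where
  "multiplicative_group = \<lparr>carrier = {x. x \<noteq> 0}, mult = (*), one = 1\<rparr>"

text \<open>As \<open>k[k\<^sup>*] = k[t, t\<^sup>-\<^sup>1]\<close>, a map \<open>\<phi>\<close> from \<open>G\<close> to \<open>k\<^sup>*\<close> is a morphism of varieties iff both
  \<open>\<phi>\<close> and its pointwise inverse are regular. (Both vanish outside \<open>G\<close>, since \<open>inverse 0 = 0\<close>.)\<close>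

definition characters :: "(('k::field) ^ 'n) monoid \<Rightarrow> ('k ^ 'n \<Rightarrow> 'k) set" where
  "characters G = {\<phi>. \<phi> \<in> coordinate_ring (carrier G) \<and>
     (\<lambda>x. inverse (\<phi> x)) \<in> coordinate_ring (carrier G) \<and>
     \<phi> \<in> hom G multiplicative_group}"

text \<open>The last assumption says that every element of \<open>A\<close> lies in a finite-dimensional \<open>G\<close>-stable
  subspace \<open>span B\<close>, on which \<open>G\<close> acts through matrices with regular entries. The inverse of
  the determinant of such a matrix is then regular as well, being the determinant at \<open>g\<^sup>-\<^sup>1\<close>.\<close>

locale rational_action =
  k_algebra smul + affine_algebraic_group G + group_action G UNIV act
  for smul :: "('k::alg_closed_field) \<Rightarrow> 'a::comm_ring_1 \<Rightarrow> 'a"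
    and G :: "('k ^ 'n) monoid"
    and act :: "'k ^ 'n \<Rightarrow> 'a \<Rightarrow> 'a" +
  assumes act_one: "g \<in> carrier G \<Longrightarrow> act g 1 = 1"
    and act_add: "g \<in> carrier G \<Longrightarrow> act g (x + y) = act g x + act g y"
    and act_mult: "g \<in> carrier G \<Longrightarrow> act g (x * y) = act g x * act g y"
    and act_scale: "g \<in> carrier G \<Longrightarrow> act g (smul c x) = smul c (act g x)"
    and rational:
      "\<exists>B c. finite B \<and> independent B \<and> a \<in> span B \<and>
         (\<forall>b\<in>B. \<forall>b'\<in>B. c b' b \<in> coordinate_ring (carrier G)) \<and>
         (\<forall>g\<in>carrier G. \<forall>b\<in>B. act g b = (\<Sum>b'\<in>B. smul (c b' b g) b'))"


section \<open>Tensor products over the ground field\<close>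

text \<open>Tensor products of subspaces \<open>U\<close>, \<open>V\<close>, \<open>W\<close> of vector spaces with scalar multiplications
  \<open>su\<close>, \<open>sv\<close>, \<open>sw\<close>: free abelian groups modulo the usual relations. A finite formal sum
  \<open>\<Sum>\<^sub>i u\<^sub>i \<otimes> v\<^sub>i\<close> is given by the list of the pairs \<open>(u\<^sub>i, v\<^sub>i)\<close>.\<close>

definition tensor2_relations ::
    "('k \<Rightarrow> 'u::ab_group_add \<Rightarrow> 'u) \<Rightarrow> 'u set \<Rightarrow>
     ('k \<Rightarrow> 'v::ab_group_add \<Rightarrow> 'v) \<Rightarrow> 'v set \<Rightarrow> ('u \<times> 'v \<Rightarrow>\<^sub>0 int) set" where
  "tensor2_relations su U sv V = generate (free_Abelian_group (U \<times> V))
     ({frag_of (u + u', v) - frag_of (u, v) - frag_of (u', v) | u u' v.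
         u \<in> U \<and> u' \<in> U \<and> v \<in> V} \<union>
      {frag_of (u, v + v') - frag_of (u, v) - frag_of (u, v') | u v v'.
         u \<in> U \<and> v \<in> V \<and> v' \<in> V} \<union>
      {frag_of (su c u, v) - frag_of (u, sv c v) | c u v. u \<in> U \<and> v \<in> V})"

definition tensor2 ::
    "('k \<Rightarrow> 'u::ab_group_add \<Rightarrow> 'u) \<Rightarrow> 'u set \<Rightarrow>
     ('k \<Rightarrow> 'v::ab_group_add \<Rightarrow> 'v) \<Rightarrow> 'v set \<Rightarrow> ('u \<times> 'v \<Rightarrow>\<^sub>0 int) set monoid" where
  "tensor2 su U sv V = free_Abelian_group (U \<times> V) Mod tensor2_relations su U sv V"

definition tensor2_sum ::
    "('k \<Rightarrow> 'u::ab_group_add \<Rightarrow> 'u) \<Rightarrow> 'u set \<Rightarrow>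
     ('k \<Rightarrow> 'v::ab_group_add \<Rightarrow> 'v) \<Rightarrow> 'v set \<Rightarrow> ('u \<times> 'v) list \<Rightarrow> ('u \<times> 'v \<Rightarrow>\<^sub>0 int) set" where
  "tensor2_sum su U sv V xs =
     tensor2_relations su U sv V #>\<^bsub>free_Abelian_group (U \<times> V)\<^esub> (\<Sum>x\<leftarrow>xs. frag_of x)"

definition tensor3_relations ::
    "('k \<Rightarrow> 'u::ab_group_add \<Rightarrow> 'u) \<Rightarrow> 'u set \<Rightarrow>
     ('k \<Rightarrow> 'v::ab_group_add \<Rightarrow> 'v) \<Rightarrow> 'v set \<Rightarrow>
     ('k \<Rightarrow> 'w::ab_group_add \<Rightarrow> 'w) \<Rightarrow> 'w set \<Rightarrow> ('u \<times> 'v \<times> 'w \<Rightarrow>\<^sub>0 int) set" where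
  "tensor3_relations su U sv V sw W = generate (free_Abelian_group (U \<times> V \<times> W))
     ({frag_of (u + u', v, w) - frag_of (u, v, w) - frag_of (u', v, w) | u u' v w.
         u \<in> U \<and> u' \<in> U \<and> v \<in> V \<and> w \<in> W} \<union>
      {frag_of (u, v + v', w) - frag_of (u, v, w) - frag_of (u, v', w) | u v v' w.
         u \<in> U \<and> v \<in> V \<and> v' \<in> V \<and> w \<in> W} \<union>
      {frag_of (u, v, w + w') - frag_of (u, v, w) - frag_of (u, v, w') | u v w w'.
         u \<in> U \<and> v \<in> V \<and> w \<in> W \<and> w' \<in> W} \<union>
      {frag_of (su c u, v, w) - frag_of (u, sv c v, w) | c u v w.
         u \<in> U \<and> v \<in> V \<and> w \<in> W} \<union>
      {frag_of (u, sv c v, w) - frag_of (u, v, sw c w) | c u v w.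
         u \<in> U \<and> v \<in> V \<and> w \<in> W})"

definition tensor3_sum ::
    "('k \<Rightarrow> 'u::ab_group_add \<Rightarrow> 'u) \<Rightarrow> 'u set \<Rightarrow>
     ('k \<Rightarrow> 'v::ab_group_add \<Rightarrow> 'v) \<Rightarrow> 'v set \<Rightarrow>
     ('k \<Rightarrow> 'w::ab_group_add \<Rightarrow> 'w) \<Rightarrow> 'w set \<Rightarrow>
     ('u \<times> 'v \<times> 'w) list \<Rightarrow> ('u \<times> 'v \<times> 'w \<Rightarrow>\<^sub>0 int) set" where
  "tensor3_sum su U sv V sw W xs =
     tensor3_relations su U sv V sw W #>\<^bsub>free_Abelian_group (U \<times> V \<times> W)\<^esub>
       (\<Sum>x\<leftarrow>xs. frag_of x)"


section \<open>The Hopf algebra \<open>H = k[G]\<close> and the coring \<open>A \<otimes> H\<close>\<close>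

abbreviation HH_sum where
  "HH_sum G \<equiv> tensor2_sum fun_scale (coordinate_ring (carrier G))
                          fun_scale (coordinate_ring (carrier G))"

abbreviation AH where
  "AH smul G \<equiv> tensor2 smul UNIV fun_scale (coordinate_ring (carrier G))"

abbreviation AH_sum where
  "AH_sum smul G \<equiv> tensor2_sum smul UNIV fun_scale (coordinate_ring (carrier G))"

abbreviation AHH_sum where
  "AHH_sum smul G \<equiv> tensor3_sum smul UNIV fun_scale (coordinate_ring (carrier G))
                                            fun_scale (coordinate_ring (carrier G))"

text \<open>\<open>\<Delta>(f) = f\<^sub>1 \<otimes> f\<^sub>2\<close> is the unique element of \<open>H \<otimes> H\<close> with \<open>f(gg') = f\<^sub>1(g) f\<^sub>2(g')\<close>.\<close>

definition comult ::
    "(('k::field) ^ 'n) monoid \<Rightarrow> ('k ^ 'n \<Rightarrow> 'k) \<Rightarrow>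
     (('k ^ 'n \<Rightarrow> 'k) \<times> ('k ^ 'n \<Rightarrow> 'k) \<Rightarrow>\<^sub>0 int) set" where
  "comult G f = (THE t. \<exists>ds.
     set ds \<subseteq> coordinate_ring (carrier G) \<times> coordinate_ring (carrier G) \<and>
     t = HH_sum G ds \<and>
     (\<forall>g\<in>carrier G. \<forall>g'\<in>carrier G. f (g \<otimes>\<^bsub>G\<^esub> g') = (\<Sum>(f1, f2)\<leftarrow>ds. f1 g * f2 g')))"

definition counit :: "(('k::field) ^ 'n) monoid \<Rightarrow> ('k ^ 'n \<Rightarrow> 'k) \<Rightarrow> 'k" where
  "counit G f = f \<one>\<^bsub>G\<^esub>"

text \<open>\<open>a\<^sub>0 \<otimes> a\<^sub>1\<close> is the unique element of \<open>A \<otimes> H\<close> with \<open>g.a = a\<^sub>0 a\<^sub>1(g)\<close>.\<close>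

definition coaction ::
    "(('k::field) \<Rightarrow> 'a::comm_ring_1 \<Rightarrow> 'a) \<Rightarrow> ('k ^ 'n) monoid \<Rightarrow> ('k ^ 'n \<Rightarrow> 'a \<Rightarrow> 'a) \<Rightarrow>
     'a \<Rightarrow> ('a \<times> ('k ^ 'n \<Rightarrow> 'k) \<Rightarrow>\<^sub>0 int) set" where
  "coaction smul G act a = (THE t. \<exists>rs.
     set rs \<subseteq> UNIV \<times> coordinate_ring (carrier G) \<and>
     t = AH_sum smul G rs \<and>
     (\<forall>g\<in>carrier G. act g a = (\<Sum>(a0, a1)\<leftarrow>rs. smul (a1 g) a0)))"

definition hopf_grouplikes :: "(('k::field) ^ 'n) monoid \<Rightarrow> ('k ^ 'n \<Rightarrow> 'k) set" where
  "hopf_grouplikes G = {f \<in> coordinate_ring (carrier G).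
     comult G f = HH_sum G [(f, f)] \<and> counit G f = 1}"

text \<open>Sweedler notation is made explicit: \<open>xs\<close> represents the given element \<open>\<Sum>\<^sub>i a\<^sub>i \<otimes> f\<^sub>i\<close> of
  \<open>A \<otimes> H\<close>, \<open>D f\<close> represents \<open>\<Delta>(f)\<close> and \<open>R a\<close> represents the coaction on \<open>a\<close>. The two sides
  of the equation in \<open>A \<otimes> H \<otimes> H\<close> and the sum \<open>\<Sum>\<^sub>i a\<^sub>i \<epsilon>(f\<^sub>i)\<close> do not depend on these choices.\<close>

definition coring_grouplikes ::
    "(('k::field) \<Rightarrow> 'a::comm_ring_1 \<Rightarrow> 'a) \<Rightarrow> ('k ^ 'n) monoid \<Rightarrow> ('k ^ 'n \<Rightarrow> 'a \<Rightarrow> 'a) \<Rightarrow>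
     ('a \<times> ('k ^ 'n \<Rightarrow> 'k) \<Rightarrow>\<^sub>0 int) set set" where
  "coring_grouplikes smul G act = {t \<in> carrier (AH smul G). \<exists>xs D R.
     set xs \<subseteq> UNIV \<times> coordinate_ring (carrier G) \<and> t = AH_sum smul G xs \<and>
     (\<forall>(a, f)\<in>set xs.
        set (D f) \<subseteq> coordinate_ring (carrier G) \<times> coordinate_ring (carrier G) \<and>
        HH_sum G (D f) = comult G f \<and>
        set (R a) \<subseteq> UNIV \<times> coordinate_ring (carrier G) \<and>
        AH_sum smul G (R a) = coaction smul G act a) \<and>
     AHH_sum smul G [(a, f1, f2). (a, f) \<leftarrow> xs, (f1, f2) \<leftarrow> D f] =
     AHH_sum smul G [(a * b0, f * b1, h). (a, f) \<leftarrow> xs, (b, h) \<leftarrow> xs, (b0, b1) \<leftarrow> R b] \<and>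
     (\<Sum>(a, f)\<leftarrow>xs. smul (counit G f) a) = 1}"

end

theory Submission
  imports Defs
begin

text \<open>An element \<open>t = \<Sum> a\<^sub>i \<otimes> f\<^sub>i\<close> of \<open>A \<otimes> H\<close> is determined by the map \<open>F(g) = \<Sum> f\<^sub>i(g) a\<^sub>i\<close> from \<open>G\<close> to
  \<open>A\<close> (\<open>tensor2_sum_eq_iff_functions\<close>). In terms of \<open>F\<close>, being grouplike says that \<open>F(1) = 1\<close> and
  \<open>F(gh) = F(g) \<cdot> (g.F(h))\<close> (\<open>coring_grouplikes_cocycle\<close>). Every \<open>F(g)\<close> is then a unit of \<open>A\<close>, with
  inverse \<open>g.F(g\<^sup>-\<^sup>1)\<close>, which is again a regular map of \<open>g\<close>.

  The heart of the matter is that such a map has values in \<open>k\<close> (\<open>regular_units_constant\<close>), a form of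
  Rosenlicht's theorem on units of a product of varieties. Instead of divisors on a
  compactification, the proof uses all valuation rings \<open>R\<close> with \<open>k \<subseteq> R\<close> in the fraction field of
  \<open>A\<close>. Since \<open>R\<close> and its maximal ideal are \<open>k\<close>-subspaces, the conditions \<open>F(g) \<in> R\<close>,
  \<open>F(g)\<^sup>-\<^sup>1 \<in> R\<close> and the same ones for the maximal ideal are Zariski closed in \<open>g\<close>
  (\<open>closedin_evaluate_in_subspace\<close>). So \<open>F(g)\<close> is a unit of \<open>R\<close> on a set that is closed and open and
  contains \<open>1\<close>, hence on all of the connected group \<open>G\<close>. But an element outside the algebraically
  closed field \<open>k\<close> is transcendental over \<open>k\<close>, and then it is a nonunit of some \<open>R\<close>
  (\<open>ex_valuation_ring\<close>).

  Once \<open>F = \<phi> \<cdot> 1\<close> with \<open>\<phi>\<close> scalar, the cocycle identity makes \<open>\<phi>\<close> multiplicative, because \<open>G\<close> fixes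
  the scalars, and \<open>t = 1 \<otimes> \<phi>\<close>. Conversely \<open>1 \<otimes> \<phi>\<close> is grouplike since both sides of the defining
  identity are \<open>1 \<otimes> \<phi> \<otimes> \<phi>\<close>.\<close>

section \<open>Regular functions on affine varieties\<close>

lemma polynomial_functions_const: "(\<lambda>x. c) \<in> polynomial_functions"
  using subalgebra_generated.scalar[of fun_scale c]
  by (simp add: polynomial_functions_def fun_scale_def one_fun_def)

lemma polynomial_functions_add:
  "p \<in> polynomial_functions \<Longrightarrow> q \<in> polynomial_functions \<Longrightarrow> (\<lambda>x. p x + q x) \<in> polynomial_functions"
  using subalgebra_generated.add[of p fun_scale _ q]
  by (simp add: polynomial_functions_def plus_fun_def)

lemma polynomial_functions_mult:
  "p \<in> polynomial_functions \<Longrightarrow> q \<in> polynomial_functions \<Longrightarrow> (\<lambda>x. p x * q x) \<in> polynomial_functions"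
  using subalgebra_generated.mult[of p fun_scale _ q]
  by (simp add: polynomial_functions_def times_fun_def)

lemma polynomial_functions_induct [consumes 1, case_names coordinate const add mult]:
  assumes "p \<in> polynomial_functions"
    and "\<And>i. P (\<lambda>x. x $ i)" and "\<And>c. P (\<lambda>x. c)"
    and "\<And>p q. P p \<Longrightarrow> P q \<Longrightarrow> P (\<lambda>x. p x + q x)"
    and "\<And>p q. P p \<Longrightarrow> P q \<Longrightarrow> P (\<lambda>x. p x * q x)"
  shows "P p"
  using assms(1) unfolding polynomial_functions_def
proof (induction rule: subalgebra_generated.induct)
  case (generator x)
  then show ?case using assms(2) by auto
next
  case (scalar c)
  then show ?case using assms(3)[of c] by (simp add: fun_scale_def one_fun_def)
next
  case (add x y)
  then show ?case using assms(4)[of x y] by (simp add: plus_fun_def)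
next
  case (mult x y)
  then show ?case using assms(5)[of x y] by (simp add: times_fun_def)
qed

lemma coordinate_ring_iff:
  "f \<in> coordinate_ring X \<longleftrightarrow>
     (\<exists>p\<in>polynomial_functions. \<forall>x\<in>X. f x = p x) \<and> (\<forall>x. x \<notin> X \<longrightarrow> f x = 0)"
  unfolding coordinate_ring_def by (auto simp: fun_eq_iff) 

lemma coordinate_ring_outside: "f \<in> coordinate_ring X \<Longrightarrow> x \<notin> X \<Longrightarrow> f x = 0"
  by (simp add: coordinate_ring_iff)

lemma coordinate_ring_add:
  assumes "f \<in> coordinate_ring X" "h \<in> coordinate_ring X"
  shows "f + h \<in> coordinate_ring X"
proof -
  obtain p q where "p \<in> polynomial_functions" "q \<in> polynomial_functions"
    "\<forall>x\<in>X. f x = p x" "\<forall>x\<in>X. h x = q x"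
    using assms by (auto simp: coordinate_ring_iff)
  then show ?thesis
    using assms polynomial_functions_add[of p q] by (auto simp: coordinate_ring_iff)
qed

lemma coordinate_ring_mult:
  assumes "f \<in> coordinate_ring X" "h \<in> coordinate_ring X"
  shows "f * h \<in> coordinate_ring X"
proof -
  obtain p q where "p \<in> polynomial_functions" "q \<in> polynomial_functions"
    "\<forall>x\<in>X. f x = p x" "\<forall>x\<in>X. h x = q x"
    using assms by (auto simp: coordinate_ring_iff)
  then show ?thesis
    using assms polynomial_functions_mult[of p q] by (auto simp: coordinate_ring_iff)
qed

lemma coordinate_ring_const: "(\<lambda>x. if x \<in> X then c else 0) \<in> coordinate_ring X"
  using polynomial_functions_const[of c] by (auto simp: coordinate_ring_iff)

lemma coordinate_ring_zero: "0 \<in> coordinate_ring X"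
  using coordinate_ring_const[of X 0] by (simp add: zero_fun_def)

lemma coordinate_ring_scale: "f \<in> coordinate_ring X \<Longrightarrow> fun_scale c f \<in> coordinate_ring X"
proof -
  assume f: "f \<in> coordinate_ring X"
  have "fun_scale c f = (\<lambda>x. if x \<in> X then c else 0) * f"
    using coordinate_ring_outside[OF f] by (auto simp: fun_scale_def fun_eq_iff)
  then show ?thesis
    using coordinate_ring_mult[OF coordinate_ring_const f] by simp
qed

lemma fun_scale_vector_space: "vector_space (fun_scale :: 'k::field \<Rightarrow> ('x \<Rightarrow> 'k) \<Rightarrow> _)"
  by unfold_locales (auto simp: fun_scale_def fun_eq_iff algebra_simps)

lemma subspace_coordinate_ring:
  fixes X :: "(('k::field) ^ 'n) set"
  shows "module.subspace fun_scale (coordinate_ring X)"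
proof -
  interpret vector_space "fun_scale :: 'k \<Rightarrow> ('k ^ 'n \<Rightarrow> 'k) \<Rightarrow> _" by (rule fun_scale_vector_space)
  show ?thesis
    by (rule subspaceI) (auto intro: coordinate_ring_zero coordinate_ring_add coordinate_ring_scale)
qed

lemma coordinate_ring_comp_morphism:
  assumes \<phi>: "morphism X Y \<phi>" and f: "f \<in> coordinate_ring Y"
  shows "\<exists>q\<in>polynomial_functions. \<forall>x\<in>X. f (\<phi> x) = q x"
proof -
  obtain p where p: "p \<in> polynomial_functions" "\<forall>y\<in>Y. f y = p y"
    using f by (auto simp: coordinate_ring_iff)
  have "\<exists>q\<in>polynomial_functions. \<forall>x\<in>X. p (\<phi> x) = q x"
    using p(1)
  proof (induction rule: polynomial_functions_induct)
    case (coordinate i)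
    then show ?case using \<phi> by (auto simp: morphism_def)
  next
    case (const c)
    then show ?case using polynomial_functions_const[of c] by auto
  next
    case (add p q)
    then obtain p' q' where "p' \<in> polynomial_functions" "q' \<in> polynomial_functions"
      "\<forall>x\<in>X. p (\<phi> x) = p' x" "\<forall>x\<in>X. q (\<phi> x) = q' x" by blast
    then show ?case
      by (intro bexI[of _ "\<lambda>x. p' x + q' x"] polynomial_functions_add) auto
  next
    case (mult p q)
    then obtain p' q' where "p' \<in> polynomial_functions" "q' \<in> polynomial_functions"
      "\<forall>x\<in>X. p (\<phi> x) = p' x" "\<forall>x\<in>X. q (\<phi> x) = q' x" by blast
    then show ?case
      by (intro bexI[of _ "\<lambda>x. p' x * q' x"] polynomial_functions_mult) auto
  qed
  moreover have "\<phi> x \<in> Y" if "x \<in> X" for x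
    using \<phi> that by (auto simp: morphism_def)
  ultimately show ?thesis using p(2) by auto
qed

text \<open>This makes the comultiplication exist: composing a regular function with the group law
  gives a polynomial in two groups of variables, and each monomial is a product.\<close>

lemma polynomial_function_separate:
  fixes p :: "('k::field) ^ ('m::finite + 'n::finite) \<Rightarrow> 'k"
  assumes "p \<in> polynomial_functions"
  shows "\<exists>ds. set ds \<subseteq> polynomial_functions \<times> polynomial_functions \<and>
    (\<forall>z. p z = (\<Sum>(p1, p2)\<leftarrow>ds. p1 (left_part z) * p2 (right_part z)))"
  using assms
proof (induction rule: polynomial_functions_induct)
  case (coordinate i)
  have c: "(\<lambda>x. x $ j) \<in> polynomial_functions" for j
    unfolding polynomial_functions_def by (rule subalgebra_generated.generator) simp
  show ?case
  proof (cases i)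
    case (Inl j)
    then show ?thesis
      by (intro exI[of _ "[(\<lambda>x. x $ j, \<lambda>x. 1)]"])
        (auto simp: left_part_def c polynomial_functions_const)
  next
    case (Inr j)
    then show ?thesis
      by (intro exI[of _ "[(\<lambda>x. 1, \<lambda>x. x $ j)]"])
        (auto simp: right_part_def c polynomial_functions_const)
  qed
next
  case (const c)
  show ?case
    by (intro exI[of _ "[(\<lambda>x. c, \<lambda>x. 1)]"]) (auto simp: polynomial_functions_const)
next
  case (add p q)
  then obtain ds es where
    "set ds \<subseteq> polynomial_functions \<times> polynomial_functions"
    "\<forall>z. p z = (\<Sum>(p1, p2)\<leftarrow>ds. p1 (left_part z) * p2 (right_part z))"
    "set es \<subseteq> polynomial_functions \<times> polynomial_functions"
    "\<forall>z. q z = (\<Sum>(p1, p2)\<leftarrow>es. p1 (left_part z) * p2 (right_part z))" by blast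
  then show ?case by (intro exI[of _ "ds @ es"]) auto
next
  case (mult p q)
  then obtain ds es where
    ds: "set ds \<subseteq> polynomial_functions \<times> polynomial_functions"
    "\<forall>z. p z = (\<Sum>(p1, p2)\<leftarrow>ds. p1 (left_part z) * p2 (right_part z))" and
    es: "set es \<subseteq> polynomial_functions \<times> polynomial_functions"
    "\<forall>z. q z = (\<Sum>(p1, p2)\<leftarrow>es. p1 (left_part z) * p2 (right_part z))" by blast
  let ?l = "[(\<lambda>x. p1 x * q1 x, \<lambda>x. p2 x * q2 x). (p1, p2) \<leftarrow> ds, (q1, q2) \<leftarrow> es]"
  have "(\<Sum>(p1, p2)\<leftarrow>?l. p1 (left_part z) * p2 (right_part z)) = p z * q z" for z
  proof -
    have inner: "(\<Sum>(q1', q2')\<leftarrow>[(\<lambda>x. p1 x * q1 x, \<lambda>x. p2 x * q2 x). (q1, q2) \<leftarrow> es].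
        q1' (left_part z) * q2' (right_part z)) = p1 (left_part z) * p2 (right_part z) * q z" for p1 p2
      unfolding es(2)[rule_format]
      by (induction es) (auto simp: algebra_simps)
    show ?thesis
      unfolding ds(2)[rule_format]
      by (induction ds) (auto simp: inner algebra_simps simp del: map_map)
  qed
  moreover have "set ?l \<subseteq> polynomial_functions \<times> polynomial_functions"
    using ds(1) es(1) by (auto intro!: polynomial_functions_mult)
  ultimately show ?case by (intro exI[of _ ?l]) auto
qed


section \<open>Equality of elements of tensor products\<close>

text \<open>The additive extension of \<open>val\<close> to formal integer combinations. A tensor is a coset of
  such combinations, so two combinations of the same tensor are told to have the same value by
  checking \<open>val\<close> on the generators of the relations only.\<close>

definition frag_eval :: "('x \<Rightarrow> 'r::comm_ring_1) \<Rightarrow> ('x \<Rightarrow>\<^sub>0 int) \<Rightarrow> 'r" where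
  "frag_eval val c = (\<Sum>x\<in>Poly_Mapping.keys c. of_int (Poly_Mapping.lookup c x) * val x)"

lemma frag_eval_superset:
  assumes "finite S" and "Poly_Mapping.keys c \<subseteq> S"
  shows "frag_eval val c = (\<Sum>x\<in>S. of_int (Poly_Mapping.lookup c x) * val x)"
  unfolding frag_eval_def
  by (rule sum.mono_neutral_left) (use assms in \<open>auto simp: in_keys_iff\<close>)

lemma frag_eval_add: "frag_eval val (c + d) = frag_eval val c + frag_eval val d"
proof -
  let ?S = "Poly_Mapping.keys c \<union> Poly_Mapping.keys d"
  have "frag_eval val (c + d) = (\<Sum>x\<in>?S. of_int (Poly_Mapping.lookup (c + d) x) * val x)"
    using Poly_Mapping.keys_add[of c d] by (intro frag_eval_superset) auto
  also have "\<dots> = frag_eval val c + frag_eval val d"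
    by (subst (1 2) frag_eval_superset[of ?S])
      (auto simp: lookup_add sum.distrib algebra_simps)
  finally show ?thesis .
qed

lemma frag_eval_zero [simp]: "frag_eval val 0 = 0"
  by (simp add: frag_eval_def)

lemma frag_eval_uminus: "frag_eval val (- c) = - frag_eval val c"
  using frag_eval_add[of val "-c" c] by (simp add: eq_neg_iff_add_eq_0)

lemma frag_eval_diff: "frag_eval val (c - d) = frag_eval val c - frag_eval val d"
  using frag_eval_add[of val c "-d"] by (simp add: frag_eval_uminus)

lemma frag_eval_frag_of [simp]: "frag_eval val (frag_of x) = val x"
  by (simp add: frag_eval_def)

lemma frag_eval_sum_list: "frag_eval val (\<Sum>x\<leftarrow>xs. frag_of x) = (\<Sum>x\<leftarrow>xs. val x)"
  by (induction xs) (simp_all add: frag_eval_add)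

lemma free_Abelian_group_cosets_eq:
  assumes N: "subgroup N (free_Abelian_group S)" and "x - y \<in> N"
  shows "N #>\<^bsub>free_Abelian_group S\<^esub> x = N #>\<^bsub>free_Abelian_group S\<^esub> y"
proof -
  have add: "a + b \<in> N" if "a \<in> N" "b \<in> N" for a b
    using subgroup.m_closed[OF N that] by simp
  have "- (x - y) \<in> N"
    using subgroup.m_inv_closed[OF N assms(2)] subgroup.mem_carrier[OF N assms(2)] by simp
  then have yx: "y - x \<in> N" by simp
  have "\<exists>n'\<in>N. n + x = n' + y" "\<exists>n'\<in>N. n + y = n' + x" if "n \<in> N" for n
    using add[OF that assms(2)] add[OF that yx]
    by (metis add.commute add_diff_eq diff_add_cancel)+
  then show ?thesis
    by (auto simp: r_coset_def)
qed

lemma frag_eval_generate_eq_0: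
  assumes "c \<in> generate (free_Abelian_group S) Gens"
    and "Gens \<subseteq> carrier (free_Abelian_group S)"
    and "\<And>d. d \<in> Gens \<Longrightarrow> frag_eval val d = 0"
  shows "frag_eval val c = 0"
  using assms(1)
proof (induction rule: generate.induct)
  case (inv h)
  then show ?case using assms(2,3) by (auto simp: frag_eval_uminus subset_iff)
qed (use assms in \<open>auto simp: frag_eval_add\<close>)

lemma frag_eval_eq_if_cosets_eq:
  assumes eq: "generate (free_Abelian_group S) Gens #>\<^bsub>free_Abelian_group S\<^esub> x =
      generate (free_Abelian_group S) Gens #>\<^bsub>free_Abelian_group S\<^esub> y"
    and "Gens \<subseteq> carrier (free_Abelian_group S)"
    and "\<And>d. d \<in> Gens \<Longrightarrow> frag_eval val d = 0"
  shows "frag_eval val x = frag_eval val y"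
proof -
  have "0 + x \<in> generate (free_Abelian_group S) Gens #>\<^bsub>free_Abelian_group S\<^esub> x"
    unfolding r_coset_def using generate.one[of "free_Abelian_group S" Gens] by auto
  then obtain n where "n \<in> generate (free_Abelian_group S) Gens" "0 + x = n + y"
    unfolding eq by (auto simp: r_coset_def)
  then show ?thesis
    using frag_eval_generate_eq_0[OF _ assms(2,3)] by (simp add: frag_eval_add)
qed

lemma frag_of_diff_in_carrier:
  assumes "a \<in> S" "b \<in> S"
  shows "frag_of a - frag_of b \<in> carrier (free_Abelian_group S)"
    and "c \<in> S \<Longrightarrow> frag_of a - frag_of b - frag_of c \<in> carrier (free_Abelian_group S)"
  using assms Poly_Mapping.keys_diff[of "frag_of a" "frag_of b"]
    Poly_Mapping.keys_diff[of "frag_of a - frag_of b" "frag_of c"]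
  by auto

locale tensor_factors =
  left: vector_space su + right: vector_space sv
  for su :: "'k::field \<Rightarrow> 'u::ab_group_add \<Rightarrow> 'u" and sv :: "'k \<Rightarrow> 'v::ab_group_add \<Rightarrow> 'v" +
  fixes U :: "'u set" and V :: "'v set"
  assumes U: "left.subspace U" and V: "right.subspace V"
begin

lemmas U_closed = left.subspace_add[OF U] left.subspace_scale[OF U] left.subspace_0[OF U]
lemmas V_closed = right.subspace_add[OF V] right.subspace_scale[OF V] right.subspace_0[OF V]

lemma tensor2_sum_eq_imp:
  assumes eq: "tensor2_sum su U sv V xs = tensor2_sum su U sv V ys"
    and "\<And>u u' v. u \<in> U \<Longrightarrow> u' \<in> U \<Longrightarrow> v \<in> V \<Longrightarrow> val (u + u', v) = val (u, v) + val (u', v)"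
    and "\<And>u v v'. u \<in> U \<Longrightarrow> v \<in> V \<Longrightarrow> v' \<in> V \<Longrightarrow> val (u, v + v') = val (u, v) + val (u, v')"
    and "\<And>c u v. u \<in> U \<Longrightarrow> v \<in> V \<Longrightarrow> val (su c u, v) = val (u, sv c v)"
  shows "(\<Sum>x\<leftarrow>xs. val x) = (\<Sum>x\<leftarrow>ys. val x :: 'r::comm_ring_1)"
proof -
  have "frag_eval val (\<Sum>x\<leftarrow>xs. frag_of x) = frag_eval val (\<Sum>x\<leftarrow>ys. frag_of x)"
    by (rule frag_eval_eq_if_cosets_eq[OF eq[unfolded tensor2_sum_def tensor2_relations_def]])
      (auto simp: frag_eval_diff assms(2-4)
        simp del: carrier_free_Abelian_group_iff
        intro!: frag_of_diff_in_carrier U_closed V_closed)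
  then show ?thesis by (simp add: frag_eval_sum_list)
qed

lemma tensor2_relations_subgroup: "subgroup (tensor2_relations su U sv V) (free_Abelian_group (U \<times> V))"
  unfolding tensor2_relations_def
  by (rule group.generate_is_subgroup)
    (auto simp del: carrier_free_Abelian_group_iff intro!: frag_of_diff_in_carrier U_closed V_closed)

abbreviation "N \<equiv> tensor2_relations su U sv V"

lemma N_add: "a \<in> N \<Longrightarrow> b \<in> N \<Longrightarrow> a + b \<in> N"
  using subgroup.m_closed[OF tensor2_relations_subgroup] by fastforce

lemma N_zero: "0 \<in> N"
  using subgroup.one_closed[OF tensor2_relations_subgroup] by simp

lemma N_uminus: "a \<in> N \<Longrightarrow> - a \<in> N"
  using subgroup.m_inv_closed[OF tensor2_relations_subgroup, of a]
    subgroup.mem_carrier[OF tensor2_relations_subgroup, of a] by simp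

lemma N_diff: "a \<in> N \<Longrightarrow> b \<in> N \<Longrightarrow> a - b \<in> N"
  using N_add[OF _ N_uminus, of a b] by simp

lemma N_sum_list: "(\<And>x. x \<in> set xs \<Longrightarrow> h x \<in> N) \<Longrightarrow> (\<Sum>x\<leftarrow>xs. h x) \<in> N"
  by (induction xs) (auto intro: N_zero N_add)

lemma N_left: "u \<in> U \<Longrightarrow> u' \<in> U \<Longrightarrow> v \<in> V \<Longrightarrow>
    frag_of (u + u', v) - frag_of (u, v) - frag_of (u', v) \<in> N"
  and N_right: "u \<in> U \<Longrightarrow> v \<in> V \<Longrightarrow> v' \<in> V \<Longrightarrow>
    frag_of (u, v + v') - frag_of (u, v) - frag_of (u, v') \<in> N"
  and N_balanced: "u \<in> U \<Longrightarrow> v \<in> V \<Longrightarrow> frag_of (su c u, v) - frag_of (u, sv c v) \<in> N"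
  unfolding tensor2_relations_def by (rule generate.incl; blast)+

lemma N_zero_left: "v \<in> V \<Longrightarrow> frag_of (0, v) \<in> N"
  using N_uminus[OF N_left[of 0 0 v]] U_closed by simp

lemma N_zero_right: "u \<in> U \<Longrightarrow> frag_of (u, 0) \<in> N"
  using N_uminus[OF N_right[of u 0 0]] V_closed by simp

lemma N_sum_left:
  assumes "v \<in> V" and "\<And>x. x \<in> set xs \<Longrightarrow> h x \<in> U"
  shows "frag_of (\<Sum>x\<leftarrow>xs. h x, v) - (\<Sum>x\<leftarrow>xs. frag_of (h x, v)) \<in> N"
proof -
  have "(\<Sum>x\<leftarrow>xs. h x) \<in> U \<and>
      frag_of (\<Sum>x\<leftarrow>xs. h x, v) - (\<Sum>x\<leftarrow>xs. frag_of (h x, v)) \<in> N"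
    using assms(2)
  proof (induction xs)
    case Nil
    then show ?case using N_zero_left assms U_closed by simp
  next
    case (Cons a xs)
    then have IH: "(\<Sum>x\<leftarrow>xs. h x) \<in> U"
      "frag_of (\<Sum>x\<leftarrow>xs. h x, v) - (\<Sum>x\<leftarrow>xs. frag_of (h x, v)) \<in> N" "h a \<in> U" by auto
    show ?case
      using N_add[OF N_left[OF IH(3,1) assms(1)] IH(2)] IH U_closed
      by (simp add: algebra_simps)
  qed
  then show ?thesis by simp
qed

lemma tensor2_sum_eqI:
  assumes "(\<Sum>x\<leftarrow>xs. frag_of x) - (\<Sum>x\<leftarrow>ys. frag_of x) \<in> N"
  shows "tensor2_sum su U sv V xs = tensor2_sum su U sv V ys"
  unfolding tensor2_sum_def by (rule free_Abelian_group_cosets_eq[OF tensor2_relations_subgroup assms])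

lemma tensor2_sum_in_carrier:
  assumes "set xs \<subseteq> U \<times> V"
  shows "tensor2_sum su U sv V xs \<in> carrier (tensor2 su U sv V)"
proof -
  have "(\<Sum>x\<leftarrow>xs. frag_of x) \<in> carrier (free_Abelian_group (U \<times> V))"
    using assms
  proof (induction xs)
    case (Cons a xs)
    then show ?case
      using monoid.m_closed[OF group.is_monoid[OF group_free_Abelian_group], of "frag_of a" "U \<times> V"]
      by auto
  qed simp
  then show ?thesis
    unfolding tensor2_def tensor2_sum_def FactGroup_def RCOSETS_def by auto
qed

end

text \<open>If \<open>V\<close> consists of functions on \<open>X\<close>, then \<open>u \<otimes> f \<mapsto> (x \<mapsto> f(x)u)\<close> maps \<open>U \<otimes> V\<close> to the maps
  from \<open>X\<close> to \<open>U\<close>. The point of this locale is that the map is injective. Both \<open>A \<otimes> H\<close> and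
  \<open>H \<otimes> H\<close> are instances, and this is what makes the coaction and the comultiplication unique.\<close>

locale tensor_with_functions =
  tensor_factors su fun_scale U V
  for su :: "'k::field \<Rightarrow> 'u::ab_group_add \<Rightarrow> 'u" and U and V :: "('x \<Rightarrow> 'k) set" +
  fixes X :: "'x set"
  assumes outside: "f \<in> V \<Longrightarrow> x \<notin> X \<Longrightarrow> f x = 0"
begin

text \<open>Induction on the number of terms, which replaces the choice of a basis. If some \<open>f(x) \<noteq> 0\<close>, the
  vanishing at \<open>x\<close> writes \<open>u\<close> as a combination of the other left factors; expanding \<open>u \<otimes> f\<close>
  accordingly absorbs that term into the others without changing the values. Otherwise every
  function in the list is zero.\<close>

lemma tensor2_zeroI:
  assumes "set xs \<subseteq> U \<times> V" and "\<And>x. x \<in> X \<Longrightarrow> (\<Sum>(u, f)\<leftarrow>xs. su (f x) u) = 0"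
  shows "(\<Sum>y\<leftarrow>xs. frag_of y) \<in> N"
  using assms
proof (induction "length xs" arbitrary: xs rule: less_induct)
  case less
  show ?case
  proof (cases "\<forall>(u, f)\<in>set xs. f = 0")
    case True
    then show ?thesis
      using less.prems(1) by (intro N_sum_list) (fastforce intro: N_zero_right)
  next
    case False
    then obtain u f where uf: "(u, f) \<in> set xs" "f \<noteq> 0" by auto
    then obtain x where x: "f x \<noteq> 0" by (auto simp: fun_eq_iff)
    obtain ys zs where xs: "xs = ys @ (u, f) # zs" using uf(1) by (meson split_list)
    define ws where "ws = ys @ zs"
    define c where "c h = - h x / f x" for h :: "'x \<Rightarrow> 'k"
    \<comment> \<open>Moving the coefficients across turns \<open>u \<otimes> f\<close> into \<open>\<Sum> w \<otimes> c(h)f\<close>.\<close>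
    define xs' where "xs' = map (\<lambda>(w, h). (w, h + fun_scale (c h) f)) ws"
    have u: "u \<in> U" and f: "f \<in> V" and ws: "\<And>w h. (w, h) \<in> set ws \<Longrightarrow> w \<in> U \<and> h \<in> V"
      using less.prems(1) by (auto simp: xs ws_def)
    have x_in: "x \<in> X" using outside[OF f] x by blast
    have ev: "(\<Sum>(w, h)\<leftarrow>ws. su (h y) w) + su (f y) u = 0" if "y \<in> X" for y
      using less.prems(2)[OF that] by (simp add: xs ws_def algebra_simps)
    have scale: "su a (\<Sum>z\<leftarrow>zs. k z) = (\<Sum>z\<leftarrow>zs. su a (k z))" for a k and zs :: "('u \<times> ('x \<Rightarrow> 'k)) list"
      by (induction zs) (auto simp: left.scale_right_distrib)
    have u_eq: "u = (\<Sum>(w, h)\<leftarrow>ws. su (c h) w)"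
    proof -
      have "su (f x) u = - (\<Sum>(w, h)\<leftarrow>ws. su (h x) w)"
        using ev[OF x_in] by (simp add: eq_neg_iff_add_eq_0 add.commute)
      then have "su (- inverse (f x)) (\<Sum>(w, h)\<leftarrow>ws. su (h x) w) = su (inverse (f x)) (su (f x) u)"
        by simp
      also have "\<dots> = u" using x by simp
      finally show ?thesis
        unfolding scale by (simp add: c_def case_prod_unfold divide_inverse mult.commute)
    qed
    have "(\<Sum>y\<leftarrow>xs'. frag_of y) \<in> N"
    proof (rule less.hyps)
      show "length xs' < length xs" by (simp add: xs'_def ws_def xs)
      show "set xs' \<subseteq> U \<times> V" using ws f V_closed by (fastforce simp: xs'_def)
      fix y assume y: "y \<in> X"
      have "(\<Sum>(w, h)\<leftarrow>xs'. su (h y) w) = (\<Sum>(w, h)\<leftarrow>ws. su (h y) w + su (f y) (su (c h) w))"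
        by (simp add: xs'_def case_prod_unfold o_def fun_scale_def left.scale_left_distrib mult.commute)
      also have "\<dots> = (\<Sum>(w, h)\<leftarrow>ws. su (h y) w) + su (f y) u"
        by (subst u_eq) (simp add: scale case_prod_unfold sum_list_addf)
      finally show "(\<Sum>(w, h)\<leftarrow>xs'. su (h y) w) = 0" using ev[OF y] by simp
    qed
    moreover have "(\<Sum>y\<leftarrow>xs'. frag_of y) - (\<Sum>y\<leftarrow>xs. frag_of y) \<in> N"
    proof -
      have "(frag_of (w, h + fun_scale (c h) f) - frag_of (w, h) - frag_of (w, fun_scale (c h) f))
          - (frag_of (su (c h) w, f) - frag_of (w, fun_scale (c h) f)) \<in> N" if "(w, h) \<in> set ws" for w h
        using ws[OF that] f V_closed by (intro N_diff N_right N_balanced) simp_all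
      then have "(\<Sum>(w, h)\<leftarrow>ws. (frag_of (w, h + fun_scale (c h) f) - frag_of (w, h) - frag_of (w, fun_scale (c h) f))
          - (frag_of (su (c h) w, f) - frag_of (w, fun_scale (c h) f))) \<in> N"
        by (intro N_sum_list) (simp only: split_paired_all prod.case)
      also have "(\<Sum>(w, h)\<leftarrow>ws. (frag_of (w, h + fun_scale (c h) f) - frag_of (w, h) - frag_of (w, fun_scale (c h) f))
          - (frag_of (su (c h) w, f) - frag_of (w, fun_scale (c h) f)))
        = (\<Sum>y\<leftarrow>xs'. frag_of y) - (\<Sum>y\<leftarrow>ws. frag_of y) - (\<Sum>(w, h)\<leftarrow>ws. frag_of (su (c h) w, f))"
        unfolding xs'_def by (induction ws) (auto simp: algebra_simps)
      finally have 1: "\<dots> \<in> N" .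
      have 2: "frag_of (u, f) - (\<Sum>(w, h)\<leftarrow>ws. frag_of (su (c h) w, f)) \<in> N"
        using N_sum_left[OF f, of ws "\<lambda>(w, h). su (c h) w"] ws U_closed
        by (subst u_eq) (auto simp: case_prod_unfold)
      have "(\<Sum>y\<leftarrow>xs'. frag_of y) - (\<Sum>y\<leftarrow>xs. frag_of y)
        = ((\<Sum>y\<leftarrow>xs'. frag_of y) - (\<Sum>y\<leftarrow>ws. frag_of y) - (\<Sum>(w, h)\<leftarrow>ws. frag_of (su (c h) w, f)))
          - (frag_of (u, f) - (\<Sum>(w, h)\<leftarrow>ws. frag_of (su (c h) w, f)))"
        by (simp add: xs ws_def)
      then show ?thesis using N_diff[OF 1 2] by (simp only:)
    qed
    ultimately show ?thesis
      using N_diff[of "\<Sum>y\<leftarrow>xs'. frag_of y"] by fastforce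
  qed
qed

text \<open>A difference of tensors is again given by a list, with the left factors \<open>-u\<close> in the second
  part; to that list the vanishing criterion applies.\<close>

lemma tensor2_sum_eqI_functions:
  assumes xs: "set xs \<subseteq> U \<times> V" and ys: "set ys \<subseteq> U \<times> V"
    and eq: "\<And>x. x \<in> X \<Longrightarrow> (\<Sum>(u, f)\<leftarrow>xs. su (f x) u) = (\<Sum>(u, f)\<leftarrow>ys. su (f x) u)"
  shows "tensor2_sum su U fun_scale V xs = tensor2_sum su U fun_scale V ys"
proof (rule tensor2_sum_eqI)
  define ys' where "ys' = map (\<lambda>(u, f). (- u, f)) ys"
  have neg: "- u \<in> U" if "u \<in> U" for u
    using left.subspace_neg[OF U that] .
  have "(\<Sum>y\<leftarrow>xs @ ys'. frag_of y) \<in> N"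
  proof (rule tensor2_zeroI)
    show "set (xs @ ys') \<subseteq> U \<times> V" using xs ys neg by (auto simp: ys'_def)
    fix x assume x: "x \<in> X"
    have "(\<Sum>(u, f)\<leftarrow>ys'. su (f x) u) = - (\<Sum>(u, f)\<leftarrow>ys. su (f x) u)"
      unfolding ys'_def by (induction ys) auto
    then show "(\<Sum>(u, f)\<leftarrow>xs @ ys'. su (f x) u) = 0" using eq[OF x] by simp
  qed
  moreover have "(\<Sum>y\<leftarrow>ys'. frag_of y) + (\<Sum>y\<leftarrow>ys. frag_of y) \<in> N"
    using ys unfolding ys'_def
  proof (induction ys)
    case (Cons y ys)
    obtain u f where y: "y = (u, f)" "u \<in> U" "f \<in> V" using Cons.prems by auto
    have "frag_of (- u, f) + frag_of (u, f) \<in> N"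
      using N_diff[OF N_zero_left[OF y(3)] N_left[OF neg[OF y(2)] y(2,3)]] by (simp add: algebra_simps)
    from N_add[OF this Cons.IH] show ?case using Cons.prems by (simp add: y algebra_simps)
  qed (simp add: N_zero)
  ultimately show "(\<Sum>y\<leftarrow>xs. frag_of y) - (\<Sum>y\<leftarrow>ys. frag_of y) \<in> N"
    using N_diff[of "\<Sum>y\<leftarrow>xs @ ys'. frag_of y"] by fastforce
qed

end

lemma tensor2_sum_eq_iff_functions:
  fixes su :: "'k::field \<Rightarrow> 'u::comm_ring_1 \<Rightarrow> 'u"
  assumes "tensor_with_functions su U V X"
    and "set xs \<subseteq> U \<times> V" "set ys \<subseteq> U \<times> V"
  shows "tensor2_sum su U fun_scale V xs = tensor2_sum su U fun_scale V ys \<longleftrightarrow>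
     (\<forall>x\<in>X. (\<Sum>(u, f)\<leftarrow>xs. su (f x) u) = (\<Sum>(u, f)\<leftarrow>ys. su (f x) u))"
proof -
  interpret tensor_with_functions su U V X by fact
  show ?thesis
  proof (intro iffI ballI)
    fix x assume eq: "tensor2_sum su U fun_scale V xs = tensor2_sum su U fun_scale V ys"
    show "(\<Sum>(u, f)\<leftarrow>xs. su (f x) u) = (\<Sum>(u, f)\<leftarrow>ys. su (f x) u)"
      by (rule tensor2_sum_eq_imp[OF eq])
        (auto simp: left.scale_right_distrib left.scale_left_distrib fun_scale_def mult.commute)
  qed (use assms tensor2_sum_eqI_functions in blast)
qed

lemma tensor3_sum_eq_imp:
  assumes "vector_space su" "module.subspace su U" "vector_space sv" "module.subspace sv V"
    and "vector_space sw" "module.subspace sw W"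
    and eq: "tensor3_sum su U sv V sw W xs = tensor3_sum su U sv V sw W ys"
    and val: "\<And>u u' v w. u \<in> U \<Longrightarrow> u' \<in> U \<Longrightarrow> v \<in> V \<Longrightarrow> w \<in> W \<Longrightarrow>
        val (u + u', v, w) = val (u, v, w) + val (u', v, w)"
      "\<And>u v v' w. u \<in> U \<Longrightarrow> v \<in> V \<Longrightarrow> v' \<in> V \<Longrightarrow> w \<in> W \<Longrightarrow>
        val (u, v + v', w) = val (u, v, w) + val (u, v', w)"
      "\<And>u v w w'. u \<in> U \<Longrightarrow> v \<in> V \<Longrightarrow> w \<in> W \<Longrightarrow> w' \<in> W \<Longrightarrow>
        val (u, v, w + w') = val (u, v, w) + val (u, v, w')"
      "\<And>c u v w. u \<in> U \<Longrightarrow> v \<in> V \<Longrightarrow> w \<in> W \<Longrightarrow> val (su c u, v, w) = val (u, sv c v, w)"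
      "\<And>c u v w. u \<in> U \<Longrightarrow> v \<in> V \<Longrightarrow> w \<in> W \<Longrightarrow> val (u, sv c v, w) = val (u, v, sw c w)"
  shows "(\<Sum>x\<leftarrow>xs. val x) = (\<Sum>x\<leftarrow>ys. val x :: 'r::comm_ring_1)"
proof -
  interpret u: vector_space su by fact
  interpret v: vector_space sv by fact
  interpret w: vector_space sw by fact
  have "frag_eval val (\<Sum>x\<leftarrow>xs. frag_of x) = frag_eval val (\<Sum>x\<leftarrow>ys. frag_of x)"
    by (rule frag_eval_eq_if_cosets_eq[OF eq[unfolded tensor3_sum_def tensor3_relations_def]])
      (use assms(2,4,6) in \<open>auto simp: frag_eval_diff val
        u.subspace_add u.subspace_scale v.subspace_add v.subspace_scale w.subspace_add w.subspace_scale
        simp del: carrier_free_Abelian_group_iff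
        intro!: frag_of_diff_in_carrier\<close>)
  then show ?thesis by (simp add: frag_eval_sum_list)
qed


section \<open>Valuation rings of a field over an algebraically closed subfield\<close>

definition unital_subring :: "'f::comm_ring_1 set \<Rightarrow> bool" where
  "unital_subring R \<longleftrightarrow> 1 \<in> R \<and> (\<forall>x\<in>R. \<forall>y\<in>R. x - y \<in> R \<and> x * y \<in> R)"

definition adjoin :: "'f::comm_ring_1 set \<Rightarrow> 'f \<Rightarrow> 'f set" where
  "adjoin R y = {poly p y | p. \<forall>i. coeff p i \<in> R}"

context
  fixes R :: "'f::comm_ring_1 set"
  assumes R: "unital_subring R"
begin

lemma unital_subring_one: "1 \<in> R"
  and unital_subring_diff: "x \<in> R \<Longrightarrow> y \<in> R \<Longrightarrow> x - y \<in> R"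
  and unital_subring_mult: "x \<in> R \<Longrightarrow> y \<in> R \<Longrightarrow> x * y \<in> R"
  using R by (auto simp: unital_subring_def)

lemma unital_subring_zero: "0 \<in> R"
  using unital_subring_diff[OF unital_subring_one unital_subring_one] by simp

lemma unital_subring_uminus: "x \<in> R \<Longrightarrow> - x \<in> R"
  using unital_subring_diff[OF unital_subring_zero, of x] by simp

lemma unital_subring_add: "x \<in> R \<Longrightarrow> y \<in> R \<Longrightarrow> x + y \<in> R"
  using unital_subring_diff[OF _ unital_subring_uminus, of x y] by simp

lemma unital_subring_sum: "(\<And>i. i \<in> I \<Longrightarrow> h i \<in> R) \<Longrightarrow> sum h I \<in> R"
  by (induction I rule: infinite_finite_induct)
    (auto intro: unital_subring_zero unital_subring_add)

lemma unital_subring_power: "x \<in> R \<Longrightarrow> x ^ n \<in> R"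
  by (induction n) (auto intro: unital_subring_one unital_subring_mult)

lemma subset_adjoin: "R \<subseteq> adjoin R y"
proof
  fix x assume "x \<in> R"
  then show "x \<in> adjoin R y"
    unfolding adjoin_def
    by (intro CollectI exI[of _ "[:x:]"]) (auto simp: coeff_pCons unital_subring_zero split: nat.split)
qed

lemma generator_in_adjoin: "y \<in> adjoin R y"
  unfolding adjoin_def
  by (intro CollectI exI[of _ "[:0, 1:]"])
    (auto simp: coeff_pCons unital_subring_zero unital_subring_one split: nat.split)

lemma unital_subring_adjoin: "unital_subring (adjoin R y)"
  unfolding unital_subring_def
proof (intro conjI ballI)
  show "1 \<in> adjoin R y"
    using subset_adjoin unital_subring_one by blast
  fix a b assume "a \<in> adjoin R y" "b \<in> adjoin R y"
  then obtain p q where pq: "a = poly p y" "\<forall>i. coeff p i \<in> R" "b = poly q y" "\<forall>i. coeff q i \<in> R"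
    by (auto simp: adjoin_def)
  show "a - b \<in> adjoin R y"
    unfolding adjoin_def using pq
    by (intro CollectI exI[of _ "p - q"]) (auto intro: unital_subring_diff)
  show "a * b \<in> adjoin R y"
    unfolding adjoin_def using pq
    by (intro CollectI exI[of _ "p * q"])
      (auto simp: coeff_mult intro!: unital_subring_sum unital_subring_mult)
qed

end

definition maximal_subring_without :: "'f::comm_ring_1 \<Rightarrow> 'f set \<Rightarrow> bool" where
  "maximal_subring_without x R \<longleftrightarrow> unital_subring R \<and> x \<notin> R \<and>
     (\<forall>S. unital_subring S \<and> R \<subseteq> S \<and> x \<notin> S \<longrightarrow> S = R)"

text \<open>Zorn's lemma: the union of a chain of subrings that avoid \<open>x\<close> is a subring that avoids \<open>x\<close>.\<close>

lemma ex_maximal_subring_without: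
  fixes x :: "'f::comm_ring_1"
  assumes "unital_subring R0" and "x \<notin> R0"
  obtains R where "maximal_subring_without x R" and "R0 \<subseteq> R"
proof -
  let ?\<A> = "{R. unital_subring R \<and> x \<notin> R \<and> R0 \<subseteq> R}"
  have "\<exists>M\<in>?\<A>. \<forall>X\<in>?\<A>. M \<subseteq> X \<longrightarrow> X = M"
  proof (rule subset_Zorn_nonempty)
    show "?\<A> \<noteq> {}"
      using assms by blast
    fix \<C> assume ne: "\<C> \<noteq> {}" and ch: "subset.chain ?\<A> \<C>"
    then have mem: "\<And>R. R \<in> \<C> \<Longrightarrow> unital_subring R \<and> x \<notin> R \<and> R0 \<subseteq> R"
      by (auto simp: subset.chain_def)
    have "unital_subring (\<Union>\<C>)"
      unfolding unital_subring_def
    proof (intro conjI ballI)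
      show "1 \<in> \<Union>\<C>"
        using ne mem unital_subring_one by blast
      fix a b assume "a \<in> \<Union>\<C>" "b \<in> \<Union>\<C>"
      then obtain S1 S2 where S12: "S1 \<in> \<C>" "a \<in> S1" "S2 \<in> \<C>" "b \<in> S2"
        by blast
      then have "S1 \<subseteq> S2 \<or> S2 \<subseteq> S1"
        using subset.chain_total[OF ch] by blast
      then obtain S where S: "S \<in> \<C>" "a \<in> S" "b \<in> S"
        using S12 by blast
      show "a - b \<in> \<Union>\<C>" "a * b \<in> \<Union>\<C>"
        using S mem[OF S(1)] unital_subring_diff[of S a b] unital_subring_mult[of S a b]
        by blast+
    qed
    then show "\<Union>\<C> \<in> ?\<A>"
      using ne mem by blast
  qed
  then obtain M where "M \<in> ?\<A>" and max: "\<forall>X\<in>?\<A>. M \<subseteq> X \<longrightarrow> X = M"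
    by (elim bexE)
  then have M: "unital_subring M" "x \<notin> M" "R0 \<subseteq> M"
    by simp_all
  have "S = M" if "unital_subring S" "M \<subseteq> S" "x \<notin> S" for S
    using bspec[OF max, of S] that M(3) by simp
  then have "maximal_subring_without x M"
    unfolding maximal_subring_without_def using M by simp
  then show thesis
    using M(3) that by blast
qed

text \<open>A subring that is maximal among those avoiding \<open>u\<^sup>-\<^sup>1\<close> is a valuation ring. Otherwise \<open>y\<close> and
  \<open>y\<^sup>-\<^sup>1\<close> both lie outside, so by maximality \<open>u\<^sup>-\<^sup>1\<close> is a polynomial in \<open>y\<close> and also one in \<open>y\<^sup>-\<^sup>1\<close>.
  Take both of least degree. The one of smaller degree expresses \<open>1\<close> through negative powers of
  the variable of the other, which lowers the degree of the latter.\<close>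

lemma maximal_subring_inverse:
  fixes u y :: "'f::field"
  assumes max: "maximal_subring_without (inverse u) R" and u: "u \<in> R"
  shows "y \<in> R \<or> inverse y \<in> R"
proof (rule ccontr)
  let ?x = "inverse u"
  have R: "unital_subring R" and x: "?x \<notin> R"
    and top: "\<And>S. unital_subring S \<Longrightarrow> R \<subseteq> S \<Longrightarrow> ?x \<notin> S \<Longrightarrow> S = R"
    using max by (auto simp: maximal_subring_without_def)
  note sub = unital_subring_zero[OF R] unital_subring_one[OF R] unital_subring_diff[OF R]
    unital_subring_add[OF R] unital_subring_mult[OF R] unital_subring_uminus[OF R]
  have u0: "u \<noteq> 0"
    using x sub(1) by auto
  have adj: "?x \<in> adjoin R z" if "z \<notin> R" for z
    using top[OF unital_subring_adjoin[OF R], of z] subset_adjoin[OF R, of z]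
      generator_in_adjoin[OF R, of z] that by blast
  \<comment> \<open>The element \<open>u\<close> lies in the Jacobson radical: adjoining an inverse of \<open>1 - us\<close> would by
    maximality put \<open>u\<^sup>-\<^sup>1\<close> into the ring, and clearing denominators would then give \<open>u\<^sup>-\<^sup>1 \<in> R\<close>.\<close>
  have unit: "1 - u * s \<noteq> 0 \<and> inverse (1 - u * s) \<in> R" if s: "s \<in> R" for s
  proof
    let ?v = "1 - u * s"
    show v0: "?v \<noteq> 0"
    proof
      assume "?v = 0"
      then have "s = ?x"
        using u0 by (simp add: field_simps)
      then show False using s x by simp
    qed
    have pw: "\<exists>r\<in>R. ?v ^ n = 1 - u * r" for n
    proof (induction n)
      case 0
      show ?case using sub(1) by (intro bexI[of _ 0]) auto
    next
      case (Suc n)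
      then obtain r where "r \<in> R" "?v ^ n = 1 - u * r" by blast
      then have "?v ^ Suc n = 1 - u * (r + s - u * s * r)"
        by (simp only: power_Suc) (simp add: algebra_simps)
      then show ?case
        using s u sub(3-5) \<open>r \<in> R\<close> by (intro bexI[of _ "r + s - u * s * r"]) simp_all
    qed
    show "inverse ?v \<in> R"
    proof (rule ccontr)
      assume "inverse ?v \<notin> R"
      then obtain p where p: "?x = poly p (inverse ?v)" "\<forall>i. coeff p i \<in> R"
        using adj unfolding adjoin_def by blast
      define n where "n = degree p"
      obtain r where r: "r \<in> R" "?v ^ n = 1 - u * r" using pw by blast
      have "?x * ?v ^ n = (\<Sum>i\<le>n. coeff p i * ?v ^ (n - i))"
        unfolding p(1) poly_altdef n_def sum_distrib_right
        by (rule sum.cong) (use v0 in \<open>auto simp: power_diff field_simps\<close>)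
      also have "\<dots> \<in> R"
        using p(2) s u by (intro unital_subring_sum[OF R] sub unital_subring_power[OF R]) auto
      finally have "?x * (1 - u * r) \<in> R"
        by (simp only: r(2))
      moreover have "?x * (1 - u * r) = ?x - r"
        using u0 by (simp add: field_simps)
      ultimately have "?x - r \<in> R"
        by simp
      then have "?x - r + r \<in> R"
        using r(1) sub(4) by blast
      then show False using x by simp
    qed
  qed
  have shorten: "\<exists>P'. degree P' < degree P \<and> (\<forall>i. coeff P' i \<in> R) \<and> poly P' z = ?x"
    if P: "\<forall>i. coeff P i \<in> R" "poly P z = ?x" and Q: "\<forall>i. coeff Q i \<in> R" "poly Q (inverse z) = ?x"
      and le: "degree Q \<le> degree P" and z: "z \<noteq> 0" for P Q z
  proof -
    define n m where "n = degree P" and "m = degree Q"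
    have mn: "m \<le> n" using le by (simp add: n_def m_def)
    define s where "s = coeff Q"
    have s: "s j \<in> R" for j using Q by (simp add: s_def)
    define w where "w = inverse (1 - u * s 0)"
    have w: "w \<in> R" and w1: "w * (1 - u * s 0) = 1"
      using unit[OF s[of 0]] by (auto simp: w_def)
    have n0: "n > 0"
    proof (rule ccontr)
      assume "\<not> n > 0"
      then have "poly P z = coeff P 0"
        by (simp add: n_def poly_altdef)
      then show False using P x by metis
    qed
    have "?x = s 0 + (\<Sum>j=1..m. s j * inverse z ^ j)"
      using Q(2) unfolding poly_altdef s_def m_def
      by (simp add: sum.atLeast_Suc_atMost atMost_atLeast0)
    then have "1 = u * s 0 + u * (\<Sum>j=1..m. s j * inverse z ^ j)"
      using u0 by (metis distrib_left right_inverse)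
    then have "1 - u * s 0 = u * (\<Sum>j=1..m. s j * inverse z ^ j)"
      by (simp add: algebra_simps)
    then have one: "1 = w * u * (\<Sum>j=1..m. s j * inverse z ^ j)"
      using w1 by (simp add: mult.assoc)
    \<comment> \<open>Multiplying by \<open>z\<^sup>n\<close> leaves only nonnegative powers below \<open>n\<close>, since \<open>m \<le> n\<close>.\<close>
    have "z ^ n = z ^ n * (w * u * (\<Sum>j=1..m. s j * inverse z ^ j))"
      using one by simp
    also have "\<dots> = (\<Sum>j=1..m. w * u * s j * z ^ (n - j))"
      unfolding sum_distrib_left using z mn
      by (intro sum.cong) (auto simp: power_diff field_simps)
    finally have zn: "z ^ n = (\<Sum>j=1..m. w * u * s j * z ^ (n - j))" .
    define a where "a = coeff P n"
    define L where "L = (\<Sum>j=1..m. monom (a * w * u * s j) (n - j))"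
    define P' where "P' = P - monom a n + L"
    have a: "a \<in> R" using P by (simp add: a_def)
    have "poly P' z = ?x - a * z ^ n + (\<Sum>j=1..m. a * w * u * s j * z ^ (n - j))"
      by (simp add: P'_def L_def P poly_sum poly_monom)
    also have "\<dots> = ?x"
      by (subst zn) (simp add: sum_distrib_left mult.assoc)
    finally have 1: "poly P' z = ?x" .
    have 2: "coeff P' i \<in> R" for i
      unfolding P'_def L_def coeff_add coeff_diff coeff_sum coeff_monom
      using P a w u s sub
      by (intro sub(3,4) unital_subring_sum[OF R]) (auto intro!: sub(5))
    have "coeff P' i = 0" if "i \<ge> n" for i
    proof -
      have "coeff (P - monom a n) i = 0"
        using that by (cases "i = n") (auto simp: a_def n_def coeff_eq_0)
      moreover have "coeff L i = 0"
        unfolding L_def coeff_sum using that mn n0 by (intro sum.neutral) auto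
      ultimately show ?thesis by (simp add: P'_def)
    qed
    then have "degree P' < n"
      using n0 by (metis degree_less_if_less_eqI degree_0 leading_coeff_0_iff not_le_imp_less)
    then show ?thesis using 1 2 by (auto simp: n_def)
  qed
  define good where "good z P \<longleftrightarrow> (\<forall>i. coeff P i \<in> R) \<and> poly P z = ?x" for z :: 'f and P
  assume "\<not> (y \<in> R \<or> inverse y \<in> R)"
  then have "\<exists>P. good y P" "\<exists>Q. good (inverse y) Q" and y0: "y \<noteq> 0"
    using adj[of y] adj[of "inverse y"] sub(1) by (auto simp: adjoin_def good_def)
  then obtain P0 Q0 where PQ0: "good y P0" "good (inverse y) Q0" by blast
  obtain P where P: "good y P" "\<And>P'. good y P' \<Longrightarrow> degree P \<le> degree P'"
    using PQ0(1) arg_min_nat_lemma[of "good y" P0 degree] by blast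
  obtain Q where Q: "good (inverse y) Q" "\<And>Q'. good (inverse y) Q' \<Longrightarrow> degree Q \<le> degree Q'"
    using PQ0(2) arg_min_nat_lemma[of "good (inverse y)" Q0 degree] by blast
  show False
  proof (cases "degree Q \<le> degree P")
    case True
    then show False
      using shorten[of P y Q] P Q y0 unfolding good_def by (metis not_less)
  next
    case False
    then show False
      using shorten[of Q "inverse y" P] P Q y0 unfolding good_def
      by (metis inverse_inverse_eq inverse_nonzero_iff_nonzero nle_le not_less)
  qed
qed

text \<open>In a valuation ring one of \<open>a/b\<close> and \<open>b/a\<close> lies in the ring, so an inverse of \<open>a + b\<close> would
  yield an inverse of \<open>b\<close> or of \<open>a\<close>. So sums of nonunits are nonunits.\<close>

lemma nonunits_add:
  fixes a b :: "'f::field"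
  assumes R: "unital_subring R" and val: "\<And>y. y \<in> R \<or> inverse y \<in> R"
    and "a \<in> R" "b \<in> R"
    and "a = 0 \<or> inverse a \<notin> R" and "b = 0 \<or> inverse b \<notin> R"
  shows "a + b = 0 \<or> inverse (a + b) \<notin> R"
proof -
  have *: "a + b = 0 \<or> inverse (a + b) \<notin> R"
    if "b \<noteq> 0" "inverse b \<notin> R" "a / b \<in> R" for a b
  proof (rule ccontr)
    assume "\<not> ?thesis"
    then have "a + b \<noteq> 0" "inverse (a + b) \<in> R" by auto
    then have "(a / b + 1) * inverse (a + b) \<in> R"
      using that R by (intro unital_subring_mult[OF R] unital_subring_add[OF R] unital_subring_one[OF R])
    also have "(a / b + 1) * inverse (a + b) = inverse b"
      using that \<open>a + b \<noteq> 0\<close> by (simp add: field_simps)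
    finally show False using that by simp
  qed
  show ?thesis
    using *[of b a] *[of a b] val[of "a / b"] assms(5,6)
    by (cases "a = 0"; cases "b = 0") (auto simp: add.commute)
qed

text \<open>The polynomial \<open>q\<close> splits into linear factors over \<open>k\<close>, and one of them must vanish at \<open>u\<close>.\<close>

lemma algebraic_over_alg_closed:
  fixes \<iota> :: "'k::alg_closed_field \<Rightarrow> 'f::idom"
  assumes \<iota>: "\<iota> 0 = 0" "\<iota> 1 = 1" "\<And>x y. \<iota> (x + y) = \<iota> x + \<iota> y" "\<And>x y. \<iota> (x * y) = \<iota> x * \<iota> y"
    and "q \<noteq> 0" and "poly (map_poly \<iota> q) u = 0"
  shows "u \<in> range \<iota>"
  using assms(5,6)
proof (induction "degree q" arbitrary: q rule: less_induct)
  case less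
  have hom: "poly (map_poly \<iota> (pCons c p)) u = \<iota> c + u * poly (map_poly \<iota> p) u" for c p
    by (simp add: map_poly_pCons \<iota>(1))
  have add: "poly (map_poly \<iota> (p + r)) u = poly (map_poly \<iota> p) u + poly (map_poly \<iota> r) u" for p r
    by (induction p r rule: poly_induct2) (auto simp: hom \<iota> algebra_simps)
  have smult: "poly (map_poly \<iota> (smult c p)) u = \<iota> c * poly (map_poly \<iota> p) u" for c p
    by (induction p) (auto simp: hom \<iota> algebra_simps)
  have mult: "poly (map_poly \<iota> (p * r)) u = poly (map_poly \<iota> p) u * poly (map_poly \<iota> r) u" for p r
    by (induction p) (auto simp: hom add smult \<iota> algebra_simps)
  show ?case
  proof (cases "degree q = 0")
    case True
    then obtain c where "q = [:c:]" by (metis degree_eq_zeroE)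
    then have c: "c \<noteq> 0" "\<iota> c = 0" using less.prems by (auto simp: hom \<iota>)
    then have "\<iota> (c * inverse c) = 0" by (simp only: \<iota>(4)) simp
    moreover have "c * inverse c = 1" using c(1) by simp
    ultimately show ?thesis using \<iota>(2) by (metis zero_neq_one)
  next
    case False
    then obtain a where "poly q a = 0" using alg_closed_imp_poly_has_root[of q] by auto
    then obtain r where r: "q = [:-a, 1:] * r" by (metis dvdE poly_eq_0_iff_dvd)
    have r0: "r \<noteq> 0" using r less.prems by auto
    then have dr: "degree r < degree q"
      by (subst r, subst degree_mult_eq) auto
    have "(\<iota> (-a) + u) * poly (map_poly \<iota> r) u = 0"
      using less.prems(2) unfolding r mult by (simp add: hom \<iota>)
    moreover have "\<iota> (-a) + \<iota> a = 0"
      using \<iota>(3)[of "-a" a] \<iota>(1) by simp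
    ultimately have "u = \<iota> a \<or> poly (map_poly \<iota> r) u = 0"
      by (metis add.commute add_left_cancel mult_eq_0_iff)
    then show ?thesis
      using less.hyps[OF dr r0] by blast
  qed
qed

text \<open>An element outside \<open>k\<close> is transcendental, so \<open>u\<^sup>-\<^sup>1 \<notin> k[u]\<close>; enlarging \<open>k[u]\<close> to a subring
  maximal without \<open>u\<^sup>-\<^sup>1\<close> gives a valuation ring in which \<open>u\<close> is a nonunit.\<close>

lemma ex_valuation_ring:
  fixes \<iota> :: "'k::alg_closed_field \<Rightarrow> 'f::field"
  assumes \<iota>: "\<iota> 0 = 0" "\<iota> 1 = 1" "\<And>x y. \<iota> (x + y) = \<iota> x + \<iota> y" "\<And>x y. \<iota> (x * y) = \<iota> x * \<iota> y"
    and u: "u \<notin> range \<iota>"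
  obtains R where "unital_subring R" "range \<iota> \<subseteq> R" "u \<in> R" "inverse u \<notin> R"
    "\<And>y. y \<in> R \<or> inverse y \<in> R"
proof -
  have u0: "u \<noteq> 0" using u \<iota>(1) by (metis rangeI)
  have m: "\<iota> (-a) = - \<iota> a" for a
    using \<iota>(3)[of "-a" a] \<iota>(1) by (simp add: eq_neg_iff_add_eq_0)
  have k: "unital_subring (range \<iota>)"
    unfolding unital_subring_def
  proof (intro conjI ballI)
    show "1 \<in> range \<iota>" using \<iota>(2) by (metis rangeI)
    fix x y assume "x \<in> range \<iota>" "y \<in> range \<iota>"
    then obtain a b where "x = \<iota> a" "y = \<iota> b" by blast
    then have "x - y = \<iota> (a + - b)" "x * y = \<iota> (a * b)"
      by (simp_all only: \<iota>(3,4) m) simp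
    then show "x - y \<in> range \<iota>" "x * y \<in> range \<iota>" by blast+
  qed
  have "inverse u \<notin> adjoin (range \<iota>) u"
  proof
    assume "inverse u \<in> adjoin (range \<iota>) u"
    then obtain p where p: "inverse u = poly p u" "\<forall>i. coeff p i \<in> range \<iota>"
      by (auto simp: adjoin_def)
    \<comment> \<open>An equation \<open>u\<^sup>-\<^sup>1 = p(u)\<close> makes \<open>u\<close> a root of \<open>Xp - 1\<close>; \<open>\<kappa>\<close> pulls its coefficients back to \<open>k\<close>.
      Its value at \<open>0\<close> is prescribed because \<open>map_poly\<close> needs \<open>0\<close> to be fixed.\<close>
    define \<kappa> where "\<kappa> x = (if x = 0 then 0 else inv_into UNIV \<iota> x)" for x
    define q where "q = pCons (-1) (map_poly \<kappa> p)"
    have "map_poly \<iota> (map_poly \<kappa> p) = p"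
    proof (rule poly_eqI)
      fix i
      show "coeff (map_poly \<iota> (map_poly \<kappa> p)) i = coeff p i"
        using p(2) \<iota>(1) by (simp add: coeff_map_poly \<kappa>_def f_inv_into_f)
    qed
    then have "poly (map_poly \<iota> q) u = 0"
      using u0 p(1)[symmetric] by (simp add: q_def map_poly_pCons \<iota> m)
    moreover have "q \<noteq> 0" by (simp add: q_def)
    ultimately show False
      using algebraic_over_alg_closed[of \<iota> q u] \<iota> u by blast
  qed
  then obtain R where R: "maximal_subring_without (inverse u) R" "adjoin (range \<iota>) u \<subseteq> R"
    using ex_maximal_subring_without[OF unital_subring_adjoin[OF k]] by blast
  then have uR: "u \<in> R" using generator_in_adjoin[OF k] by blast
  show thesis
  proof (rule that)
    show "unital_subring R" "inverse u \<notin> R" using R(1) by (auto simp: maximal_subring_without_def)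
    show "range \<iota> \<subseteq> R" using subset_adjoin[OF k] R(2) by blast
    show "\<And>y. y \<in> R \<or> inverse y \<in> R" using maximal_subring_inverse[OF R(1) uR] .
  qed (rule uR)
qed


section \<open>Regular maps to an algebra and the Zariski topology\<close>

text \<open>The element \<open>\<Sum> a \<otimes> f\<close> of \<open>A \<otimes> k[X]\<close> seen as a regular map from \<open>X\<close> to \<open>A\<close>.\<close>

definition evaluate :: "('k \<Rightarrow> 'a::ab_group_add \<Rightarrow> 'a) \<Rightarrow> ('a \<times> ('x \<Rightarrow> 'k)) list \<Rightarrow> 'x \<Rightarrow> 'a" where
  "evaluate s xs g = (\<Sum>(a, f)\<leftarrow>xs. s (f g) a)"

lemma topspace_zariski_topology: "topspace (zariski_topology X) = X"
proof -
  have "X = {x \<in> X. (if x \<in> X then 1 else 0) \<noteq> (0 :: 'a)}" by auto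
  then have "X \<in> {{x \<in> X. f x \<noteq> 0} | f. f \<in> coordinate_ring X}"
    by (intro CollectI exI[of _ "\<lambda>x. if x \<in> X then 1 else 0"] conjI coordinate_ring_const)
  then show ?thesis
    unfolding zariski_topology_def topology_generated_by_topspace by (intro equalityI Union_upper) auto
qed

text \<open>Extend a basis of \<open>W\<close> by \<open>w\<close>, and then to a basis of the whole space.\<close>

lemma linear_functional_separating:
  fixes s :: "'k::field \<Rightarrow> 'a::ab_group_add \<Rightarrow> 'a"
  assumes "vector_space s" and W: "module.subspace s W" and w: "w \<notin> W"
  obtains l where "Vector_Spaces.linear s (*) l" "\<And>x. x \<in> W \<Longrightarrow> l x = 0" "l w = (1::'k)"
proof -
  interpret V: vector_space s by fact
  interpret K: vector_space "(*) :: 'k \<Rightarrow> 'k \<Rightarrow> 'k"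
    by unfold_locales (auto simp: algebra_simps)
  interpret VK: vector_space_pair s "(*) :: 'k \<Rightarrow> 'k \<Rightarrow> 'k" ..
  obtain B where B: "B \<subseteq> W" "V.independent B" "W \<subseteq> V.span B"
    using V.maximal_independent_subset by blast
  have "V.span B \<subseteq> W" using B(1) W by (simp add: V.span_minimal)
  then have wB: "w \<notin> V.span B" using w by blast
  then have ind: "V.independent (insert w B)"
    using B(2) V.independent_insert by (metis V.span_base)
  obtain l where l: "Vector_Spaces.linear s (*) l" "\<forall>x\<in>insert w B. l x = (if x = w then 1 else 0)"
    using VK.linear_independent_extend[OF ind, of "\<lambda>x. if x = w then 1 else 0"] by blast
  interpret l: Vector_Spaces.linear s "(*)" l by fact
  have "w \<notin> B" using wB V.span_base by blast
  then have "l x = 0" if "x \<in> B" for x using l(2) that by auto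
  then have "l x = 0" if "x \<in> V.span B" for x
    using l.eq_0_on_span[of B] that by blast
  then show thesis using that[OF l(1)] l(2) B(3) by auto
qed

lemma linear_evaluate_regular:
  fixes s :: "'k::field \<Rightarrow> 'a::ab_group_add \<Rightarrow> 'a"
  assumes "Vector_Spaces.linear s (*) l" and "set xs \<subseteq> UNIV \<times> coordinate_ring X"
  shows "(\<lambda>g. l (evaluate s xs g)) \<in> coordinate_ring X"
proof -
  interpret l: Vector_Spaces.linear s "(*)" l by fact
  show ?thesis
    using assms(2)
  proof (induction xs)
    case Nil
    then show ?case using coordinate_ring_const[of X 0] by (simp add: evaluate_def l.zero)
  next
    case (Cons p xs)
    obtain a f where p: "p = (a, f)" by (cases p)
    have "(\<lambda>g. l (evaluate s (p # xs) g)) = fun_scale (l a) f + (\<lambda>g. l (evaluate s xs g))"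
      by (auto simp: p evaluate_def l.add l.scale fun_scale_def)
    then show ?case
      using Cons by (auto simp: p intro!: coordinate_ring_add coordinate_ring_scale)
  qed
qed

text \<open>Subspaces of \<open>A\<close>, even of infinite dimension and codimension, behave like Zariski closed sets:
  a value outside \<open>W\<close> is detected by a linear functional vanishing on \<open>W\<close>, and that functional
  composed with the regular map is an ordinary regular function.\<close>

lemma closedin_evaluate_in_subspace:
  assumes "vector_space s" and "set xs \<subseteq> UNIV \<times> coordinate_ring X" and "module.subspace s W"
  shows "closedin (zariski_topology X) {g \<in> X. evaluate s xs g \<in> W}"
  unfolding closedin_def topspace_zariski_topology
proof (intro conjI)
  let ?U = "X - {g \<in> X. evaluate s xs g \<in> W}"
  show "openin (zariski_topology X) ?U"
  proof (subst openin_subopen, intro ballI)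
    fix g assume g: "g \<in> ?U"
    then have "evaluate s xs g \<notin> W" by auto
    then obtain l where l: "Vector_Spaces.linear s (*) l" "\<And>x. x \<in> W \<Longrightarrow> l x = 0"
      "l (evaluate s xs g) = 1"
      using linear_functional_separating[OF assms(1,3)] by metis
    let ?D = "{h \<in> X. l (evaluate s xs h) \<noteq> 0}"
    have "?D \<in> {{x \<in> X. f x \<noteq> 0} | f. f \<in> coordinate_ring X}"
      using linear_evaluate_regular[OF l(1) assms(2)]
      by (intro CollectI exI[of _ "\<lambda>h. l (evaluate s xs h)"] conjI refl)
    then have "openin (zariski_topology X) ?D"
      unfolding zariski_topology_def by (rule topology_generated_by_Basis)
    moreover have "g \<in> ?D" "?D \<subseteq> ?U" using g l by auto
    ultimately show "\<exists>T. openin (zariski_topology X) T \<and> g \<in> T \<and> T \<subseteq> ?U" by blast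
  qed
qed auto

text \<open>The form of Rosenlicht's theorem on units of a product that is needed here: units of
  \<open>A \<otimes> k[X]\<close> whose value at one point of the connected \<open>X\<close> is \<open>1\<close> take values in \<open>k\<close>.
  Let \<open>R\<close> be a valuation ring of the fraction field of \<open>A\<close> containing \<open>k\<close>. The set of points
  where the map \<open>F\<close> has a unit of \<open>R\<close> as value is closed, being given by the linear conditions
  \<open>F \<in> R\<close> and \<open>F\<^sup>-\<^sup>1 \<in> R\<close>. So is its complement, where \<open>F\<close> or \<open>F\<^sup>-\<^sup>1\<close> lies in the maximal ideal,
  which is a linear condition too. Hence all values are units of every such \<open>R\<close>, whereas
  a value outside \<open>k\<close> is a nonunit of some \<open>R\<close>.\<close>

lemma regular_units_constant:
  fixes smul :: "'k::alg_closed_field \<Rightarrow> 'a::idom \<Rightarrow> 'a"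
  assumes "k_algebra smul" and conn: "connected_space (zariski_topology X)"
    and xs: "set xs \<subseteq> UNIV \<times> coordinate_ring X" and ys: "set ys \<subseteq> UNIV \<times> coordinate_ring X"
    and unit: "\<And>g. g \<in> X \<Longrightarrow> evaluate smul xs g * evaluate smul ys g = 1"
    and e: "e \<in> X" "evaluate smul xs e = 1"
    and g: "g \<in> X"
  shows "evaluate smul xs g \<in> range (\<lambda>c. smul c 1)"
proof (rule ccontr)
  interpret k_algebra smul by fact
  let ?F = "evaluate smul xs" and ?F' = "evaluate smul ys"
  define \<iota> where "\<iota> c = to_fract (smul c 1)" for c
  have \<iota>_mult: "to_fract (smul c a) = \<iota> c * to_fract a" for c a
    using scale_mult_left[of c 1 a] by (simp add: \<iota>_def flip: to_fract_mult)
  have \<iota>: "\<iota> 0 = 0" "\<iota> 1 = 1" "\<iota> (c + d) = \<iota> c + \<iota> d" "\<iota> (c * d) = \<iota> c * \<iota> d" for c d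
  proof -
    show "\<iota> (c * d) = \<iota> c * \<iota> d"
      using \<iota>_mult[of c "smul d 1"] by (simp add: \<iota>_def)
  qed (simp_all add: \<iota>_def scale_left_distrib)
  assume "?F g \<notin> range (\<lambda>c. smul c 1)"
  then have "to_fract (?F g) \<notin> range \<iota>" by (auto simp: \<iota>_def)
  then obtain R where R: "unital_subring R" and kR: "range \<iota> \<subseteq> R"
    and u: "to_fract (?F g) \<in> R" "inverse (to_fract (?F g)) \<notin> R"
    and val: "\<And>y. y \<in> R \<or> inverse y \<in> R"
    using ex_valuation_ring[OF \<iota>] by metis
  have \<iota>R: "\<iota> c \<in> R" for c using kR by blast
  define W where "W = {a. to_fract a \<in> R}"
  define M where "M = {a. to_fract a \<in> R \<and> (to_fract a = 0 \<or> inverse (to_fract a) \<notin> R)}"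
  have W: "subspace W"
    by (rule subspaceI) (auto simp: W_def \<iota>_mult \<iota>R unital_subring_zero[OF R]
        intro: unital_subring_add[OF R] unital_subring_mult[OF R])
  have M: "subspace M"
  proof (rule subspaceI)
    show "0 \<in> M" by (simp add: M_def unital_subring_zero[OF R])
    fix a b assume "a \<in> M" "b \<in> M"
    then show "a + b \<in> M"
      using nonunits_add[OF R val, of "to_fract a" "to_fract b"]
      unfolding M_def mem_Collect_eq to_fract_add by (blast intro: unital_subring_add[OF R])
  next
    fix c a assume a: "a \<in> M"
    have "inverse (to_fract a) \<in> R" if "\<iota> c * to_fract a \<noteq> 0" "inverse (\<iota> c * to_fract a) \<in> R"
    proof -
      have "\<iota> c * inverse (\<iota> c * to_fract a) = inverse (to_fract a)"
        using that(1) by simp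
      then show ?thesis using unital_subring_mult[OF R \<iota>R[of c] that(2)] by (simp only:)
    qed
    moreover have "\<iota> c * to_fract a = 0" if "to_fract a = 0"
      unfolding that by simp
    ultimately show "smul c a \<in> M"
      using a unital_subring_mult[OF R \<iota>R[of c], of "to_fract a"]
      unfolding M_def mem_Collect_eq \<iota>_mult by blast
  qed
  have inv: "to_fract (?F' h) = inverse (to_fract (?F h))" "to_fract (?F h) \<noteq> 0" if "h \<in> X" for h
  proof -
    have "to_fract (?F h) * to_fract (?F' h) = 1"
      using unit[OF that] by (simp flip: to_fract_mult)
    then show "to_fract (?F' h) = inverse (to_fract (?F h))" "to_fract (?F h) \<noteq> 0"
      by (auto simp: inverse_unique)
  qed
  have closed: "closedin (zariski_topology X) {h \<in> X. ?F h \<in> S}"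
    "closedin (zariski_topology X) {h \<in> X. ?F' h \<in> S}" if "subspace S" for S
    using closedin_evaluate_in_subspace[OF vector_space_axioms _ that] xs ys by auto
  define Z where "Z = {h \<in> X. ?F h \<in> W} \<inter> {h \<in> X. ?F' h \<in> W}"
  have "X - Z = {h \<in> X. ?F h \<in> M} \<union> {h \<in> X. ?F' h \<in> M}"
    using inv val by (force simp: Z_def W_def M_def)
  then have "closedin (zariski_topology X) (X - Z)"
    by (simp only: closedin_Un closed[OF M])
  moreover have "Z \<subseteq> X" by (auto simp: Z_def)
  ultimately have "openin (zariski_topology X) Z"
    by (simp add: openin_closedin_eq topspace_zariski_topology)
  moreover have "closedin (zariski_topology X) Z"
    unfolding Z_def using closed[OF W] by blast
  moreover have "e \<in> Z"
    using e inv[OF e(1)] by (simp add: Z_def W_def unital_subring_one[OF R])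
  ultimately have "Z = X"
    using conn unfolding connected_space_clopen_in topspace_zariski_topology by blast
  then have "g \<in> Z" using g by simp
  then show False using u(2) inv[OF g] by (simp add: Z_def W_def)
qed

section \<open>Grouplike elements of \<open>k[G]\<close>\<close>

context affine_algebraic_group
begin

lemma comult_representable:
  assumes "f \<in> coordinate_ring (carrier G)"
  shows "\<exists>ds. set ds \<subseteq> coordinate_ring (carrier G) \<times> coordinate_ring (carrier G) \<and>
    (\<forall>g\<in>carrier G. \<forall>g'\<in>carrier G. f (g \<otimes> g') = (\<Sum>(f1, f2)\<leftarrow>ds. f1 g * f2 g'))"
proof -
  let ?H = "coordinate_ring (carrier G)"
  obtain q where q: "q \<in> polynomial_functions"
    "\<forall>z\<in>product_variety (carrier G) (carrier G). f (left_part z \<otimes> right_part z) = q z"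
    using coordinate_ring_comp_morphism[OF mult_morphism assms] by blast
  obtain ps where ps: "set ps \<subseteq> polynomial_functions \<times> polynomial_functions"
    "\<forall>z. q z = (\<Sum>(p1, p2)\<leftarrow>ps. p1 (left_part z) * p2 (right_part z))"
    using polynomial_function_separate[OF q(1)] by blast
  define r where "r p = (\<lambda>x. if x \<in> carrier G then p x else 0)" for p :: "'k ^ 'n \<Rightarrow> 'k"
  define ds where "ds = map (\<lambda>(p1, p2). (r p1, r p2)) ps"
  have "r p \<in> ?H" if "p \<in> polynomial_functions" for p
    using that by (auto simp: r_def coordinate_ring_iff)
  then have "set ds \<subseteq> ?H \<times> ?H" using ps(1) by (auto simp: ds_def)
  moreover have "f (g \<otimes> g') = (\<Sum>(f1, f2)\<leftarrow>ds. f1 g * f2 g')"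
    if "g \<in> carrier G" "g' \<in> carrier G" for g g'
  proof -
    define z :: "'k ^ ('n + 'n)" where "z = (\<chi> i. case i of Inl j \<Rightarrow> g $ j | Inr j \<Rightarrow> g' $ j)"
    have z: "left_part z = g" "right_part z = g'"
      by (auto simp: z_def left_part_def right_part_def vec_eq_iff)
    then have "f (g \<otimes> g') = q z" using q(2) that by (force simp: product_variety_def)
    also have "\<dots> = (\<Sum>(f1, f2)\<leftarrow>ds. f1 g * f2 g')"
      using ps(2) that by (simp add: z ds_def r_def case_prod_unfold o_def)
    finally show ?thesis .
  qed
  ultimately show ?thesis by blast
qed

lemma tensor_HH: "tensor_with_functions fun_scale (coordinate_ring (carrier G))
    (coordinate_ring (carrier G)) (carrier G)"
  by (intro tensor_with_functions.intro tensor_factors.intro tensor_factors_axioms.intro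
      tensor_with_functions_axioms.intro fun_scale_vector_space subspace_coordinate_ring coordinate_ring_outside)

text \<open>Injectivity of \<open>k[G] \<otimes> k[G] \<rightarrow> k[G \<times> G]\<close>. Evaluating the right factors at \<open>g'\<close> leaves
  a function of \<open>g\<close> that vanishes outside \<open>G\<close>, so comparing two such functions as elements of
  \<open>k[G]\<close> amounts to comparing their values on \<open>G\<close>.\<close>

lemma HH_sum_eq_iff:
  assumes ds: "set ds \<subseteq> coordinate_ring (carrier G) \<times> coordinate_ring (carrier G)"
    and es: "set es \<subseteq> coordinate_ring (carrier G) \<times> coordinate_ring (carrier G)"
  shows "HH_sum G ds = HH_sum G es \<longleftrightarrow> (\<forall>g\<in>carrier G. \<forall>g'\<in>carrier G.
    (\<Sum>(f1, f2)\<leftarrow>ds. f1 g * f2 g') = (\<Sum>(f1, f2)\<leftarrow>es. f1 g * f2 g'))"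
proof -
  have pointwise: "(\<Sum>(f1, f2)\<leftarrow>ds. fun_scale (f2 g') f1) g = (\<Sum>(f1, f2)\<leftarrow>ds. f1 g * f2 g')"
    for g g' and ds :: "(('k ^ 'n \<Rightarrow> 'k) \<times> ('k ^ 'n \<Rightarrow> 'k)) list"
    by (induction ds) (auto simp: fun_scale_def mult.commute)
  have out: "(\<Sum>(f1, f2)\<leftarrow>ds. f1 g * f2 g') = 0"
    if "set ds \<subseteq> coordinate_ring (carrier G) \<times> coordinate_ring (carrier G)" "g \<notin> carrier G"
    for g g' and ds :: "(('k ^ 'n \<Rightarrow> 'k) \<times> ('k ^ 'n \<Rightarrow> 'k)) list"
    using that by (induction ds) (auto simp: coordinate_ring_outside)
  show ?thesis
    unfolding tensor2_sum_eq_iff_functions[OF tensor_HH ds es] fun_eq_iff pointwise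
    using out[OF ds] out[OF es] by metis
qed

lemma comult_eq_iff:
  assumes f: "f \<in> coordinate_ring (carrier G)"
    and ds: "set ds \<subseteq> coordinate_ring (carrier G) \<times> coordinate_ring (carrier G)"
  shows "comult G f = HH_sum G ds \<longleftrightarrow>
    (\<forall>g\<in>carrier G. \<forall>g'\<in>carrier G. f (g \<otimes> g') = (\<Sum>(f1, f2)\<leftarrow>ds. f1 g * f2 g'))"
proof -
  obtain es where es: "set es \<subseteq> coordinate_ring (carrier G) \<times> coordinate_ring (carrier G)"
    "\<forall>g\<in>carrier G. \<forall>g'\<in>carrier G. f (g \<otimes> g') = (\<Sum>(f1, f2)\<leftarrow>es. f1 g * f2 g')"
    using comult_representable[OF f] by blast
  have "comult G f = HH_sum G es"
    unfolding comult_def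
  proof (rule the_equality)
    fix t assume "\<exists>ds. set ds \<subseteq> coordinate_ring (carrier G) \<times> coordinate_ring (carrier G) \<and>
      t = HH_sum G ds \<and>
      (\<forall>g\<in>carrier G. \<forall>g'\<in>carrier G. f (g \<otimes> g') = (\<Sum>(f1, f2)\<leftarrow>ds. f1 g * f2 g'))"
    then obtain ds where "set ds \<subseteq> coordinate_ring (carrier G) \<times> coordinate_ring (carrier G)"
      "t = HH_sum G ds"
      "\<forall>g\<in>carrier G. \<forall>g'\<in>carrier G. f (g \<otimes> g') = (\<Sum>(f1, f2)\<leftarrow>ds. f1 g * f2 g')" by blast
    then show "t = HH_sum G es" using es HH_sum_eq_iff[of ds es] by simp
  qed (use es in blast)
  then show ?thesis using HH_sum_eq_iff[OF es(1) ds] es(2) by auto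
qed

lemma hopf_grouplikes_iff:
  "\<phi> \<in> hopf_grouplikes G \<longleftrightarrow> \<phi> \<in> coordinate_ring (carrier G) \<and> \<phi> \<one> = 1 \<and>
     (\<forall>g\<in>carrier G. \<forall>g'\<in>carrier G. \<phi> (g \<otimes> g') = \<phi> g * \<phi> g')"
  using comult_eq_iff[of \<phi> "[(\<phi>, \<phi>)]"] by (auto simp: hopf_grouplikes_def counit_def)

lemma coordinate_ring_inv:
  assumes "f \<in> coordinate_ring (carrier G)"
  shows "(\<lambda>g. if g \<in> carrier G then f (inv g) else 0) \<in> coordinate_ring (carrier G)"
  using coordinate_ring_comp_morphism[OF inv_morphism assms] by (auto simp: coordinate_ring_iff)

text \<open>The inverse of a character is its composition with the inversion of \<open>G\<close>, hence regular.
  Conversely \<open>\<phi>(1)\<close> is a nonzero idempotent.\<close>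

lemma hopf_grouplikes_eq_characters: "hopf_grouplikes G = characters G"
proof (intro equalityI subsetI)
  fix \<phi> assume "\<phi> \<in> hopf_grouplikes G"
  then have H: "\<phi> \<in> coordinate_ring (carrier G)" and one: "\<phi> \<one> = 1"
    and mult: "\<And>g g'. g \<in> carrier G \<Longrightarrow> g' \<in> carrier G \<Longrightarrow> \<phi> (g \<otimes> g') = \<phi> g * \<phi> g'"
    by (auto simp: hopf_grouplikes_iff)
  have inv: "\<phi> g * \<phi> (inv g) = 1" if "g \<in> carrier G" for g
    using mult[OF that inv_closed[OF that]] that one by simp
  have "(\<lambda>g. inverse (\<phi> g)) = (\<lambda>g. if g \<in> carrier G then \<phi> (inv g) else 0)"
    using inv coordinate_ring_outside[OF H] by (auto simp: fun_eq_iff inverse_unique)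
  moreover have "\<phi> \<in> hom G multiplicative_group"
    using inv mult by (force simp: hom_def multiplicative_group_def)
  ultimately show "\<phi> \<in> characters G"
    using H coordinate_ring_inv[OF H] by (simp add: characters_def)
next
  fix \<phi> assume "\<phi> \<in> characters G"
  then have H: "\<phi> \<in> coordinate_ring (carrier G)" and nz: "\<And>g. g \<in> carrier G \<Longrightarrow> \<phi> g \<noteq> 0"
    and mult: "\<And>g g'. g \<in> carrier G \<Longrightarrow> g' \<in> carrier G \<Longrightarrow> \<phi> (g \<otimes> g') = \<phi> g * \<phi> g'"
    by (auto simp: characters_def hom_def multiplicative_group_def)
  have "\<phi> \<one> = 1" using mult[of \<one> \<one>] nz[of \<one>] by simp
  then show "\<phi> \<in> hopf_grouplikes G" using H mult by (simp add: hopf_grouplikes_iff)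
qed

end

section \<open>Grouplike elements of \<open>A \<otimes> k[G]\<close>\<close>

context rational_action
begin

lemma act_zero: "g \<in> carrier G \<Longrightarrow> act g 0 = 0"
  using act_add[of g 0 0] by simp

lemma act_evaluate:
  "g \<in> carrier G \<Longrightarrow> act g (evaluate smul xs h) = (\<Sum>(a, f)\<leftarrow>xs. smul (f h) (act g a))"
  by (induction xs) (auto simp: evaluate_def act_zero act_add act_scale)

lemma tensor_AH: "tensor_with_functions smul UNIV (coordinate_ring (carrier G)) (carrier G)"
  by (intro tensor_with_functions.intro tensor_factors.intro tensor_factors_axioms.intro
      tensor_with_functions_axioms.intro fun_scale_vector_space subspace_coordinate_ring
      coordinate_ring_outside vector_space_axioms subspace_UNIV)

lemma AH_sum_eq_iff:
  assumes "set xs \<subseteq> UNIV \<times> coordinate_ring (carrier G)" "set ys \<subseteq> UNIV \<times> coordinate_ring (carrier G)"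
  shows "AH_sum smul G xs = AH_sum smul G ys \<longleftrightarrow>
    (\<forall>g\<in>carrier G. evaluate smul xs g = evaluate smul ys g)"
  using tensor2_sum_eq_iff_functions[OF tensor_AH assms] by (simp add: evaluate_def)

lemma coaction_representable:
  "\<exists>rs. set rs \<subseteq> UNIV \<times> coordinate_ring (carrier G) \<and>
     (\<forall>g\<in>carrier G. act g a = evaluate smul rs g)"
proof -
  obtain B c where B: "finite B" "a \<in> span B"
    "\<forall>b\<in>B. \<forall>b'\<in>B. c b' b \<in> coordinate_ring (carrier G)"
    "\<forall>g\<in>carrier G. \<forall>b\<in>B. act g b = (\<Sum>b'\<in>B. smul (c b' b g) b')"
    using rational[of a] by blast
  obtain Bs where Bs: "set Bs = B" "distinct Bs" using finite_distinct_list[OF B(1)] by blast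
  obtain r where r: "a = (\<Sum>b\<leftarrow>Bs. smul (r b) b)"
    using B(2) Bs by (auto simp: span_finite[OF B(1)] sum_list_distinct_conv_sum_set)
  \<comment> \<open>The matrix of \<open>g\<close> on \<open>span B\<close>, applied to the coordinates \<open>r\<close> of \<open>a\<close>.\<close>
  define rs where "rs = [(smul (r b) b', c b' b). b \<leftarrow> Bs, b' \<leftarrow> Bs]"
  have "act g a = evaluate smul rs g" if g: "g \<in> carrier G" for g
  proof -
    have "act g (\<Sum>b\<leftarrow>bs. smul (r b) b)
        = evaluate smul [(smul (r b) b', c b' b). b \<leftarrow> bs, b' \<leftarrow> Bs] g" if "set bs \<subseteq> B" for bs
      using that
    proof (induction bs)
      case (Cons b bs)
      have "smul (r b) (act g b) = (\<Sum>b'\<leftarrow>Bs. smul (c b' b g) (smul (r b) b'))"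
        using B(4) g Cons.prems Bs
        by (simp add: scale_sum_right sum_list_distinct_conv_sum_set mult.commute)
      then show ?case
        using Cons by (simp add: evaluate_def act_add[OF g] act_scale[OF g] o_def)
    qed (simp add: evaluate_def act_zero[OF g])
    from this[of Bs] show ?thesis using Bs by (simp add: r[symmetric] rs_def)
  qed
  moreover have "set rs \<subseteq> UNIV \<times> coordinate_ring (carrier G)"
    using B(3) Bs by (auto simp: rs_def)
  ultimately show ?thesis by blast
qed

lemma coaction_eq_iff:
  assumes rs: "set rs \<subseteq> UNIV \<times> coordinate_ring (carrier G)"
  shows "AH_sum smul G rs = coaction smul G act a \<longleftrightarrow>
    (\<forall>g\<in>carrier G. act g a = evaluate smul rs g)"
proof -
  obtain es where es: "set es \<subseteq> UNIV \<times> coordinate_ring (carrier G)"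
    "\<forall>g\<in>carrier G. act g a = evaluate smul es g"
    using coaction_representable by blast
  have "coaction smul G act a = AH_sum smul G es"
    unfolding coaction_def evaluate_def[symmetric]
  proof (rule the_equality)
    fix t assume "\<exists>rs. set rs \<subseteq> UNIV \<times> coordinate_ring (carrier G) \<and> t = AH_sum smul G rs \<and>
      (\<forall>g\<in>carrier G. act g a = evaluate smul rs g)"
    then obtain rs where "set rs \<subseteq> UNIV \<times> coordinate_ring (carrier G)" "t = AH_sum smul G rs"
      "\<forall>g\<in>carrier G. act g a = evaluate smul rs g" by blast
    then show "t = AH_sum smul G es" using es AH_sum_eq_iff[of rs es] by simp
  qed (use es in blast)
  then show ?thesis using AH_sum_eq_iff[OF es(1) rs] es(2) by auto
qed

text \<open>Evaluating the identity in \<open>A \<otimes> H \<otimes> H\<close> at a pair \<open>(g, h)\<close> turns a grouplike element into a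
  multiplicative 1-cocycle of \<open>G\<close> with values in \<open>A\<close>; the left-hand side becomes \<open>F(gh)\<close> and the
  right-hand side \<open>F(g) \<cdot> (g.F(h))\<close>.\<close>

lemma coring_grouplikes_cocycle:
  assumes "t \<in> coring_grouplikes smul G act"
  obtains xs where "set xs \<subseteq> UNIV \<times> coordinate_ring (carrier G)" "t = AH_sum smul G xs"
    "evaluate smul xs \<one>\<^bsub>G\<^esub> = 1"
    "\<And>g h. g \<in> carrier G \<Longrightarrow> h \<in> carrier G \<Longrightarrow>
       evaluate smul xs (g \<otimes>\<^bsub>G\<^esub> h) = evaluate smul xs g * act g (evaluate smul xs h)"
proof -
  let ?H = "coordinate_ring (carrier G)"
  obtain xs D R where xs: "set xs \<subseteq> UNIV \<times> ?H" and t: "t = AH_sum smul G xs"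
    and DR: "\<forall>(a, f)\<in>set xs. set (D f) \<subseteq> ?H \<times> ?H \<and> HH_sum G (D f) = comult G f \<and>
        set (R a) \<subseteq> UNIV \<times> ?H \<and> AH_sum smul G (R a) = coaction smul G act a"
    and eq: "AHH_sum smul G [(a, f1, f2). (a, f) \<leftarrow> xs, (f1, f2) \<leftarrow> D f] =
     AHH_sum smul G [(a * b0, f * b1, h). (a, f) \<leftarrow> xs, (b, h) \<leftarrow> xs, (b0, b1) \<leftarrow> R b]"
    and one: "(\<Sum>(a, f)\<leftarrow>xs. smul (counit G f) a) = 1"
    using assms unfolding coring_grouplikes_def by blast
  let ?F = "evaluate smul xs"
  have "?F (g \<otimes>\<^bsub>G\<^esub> g') = ?F g * act g (?F g')" if g: "g \<in> carrier G" "g' \<in> carrier G" for g g'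
  proof -
    define val where "val = (\<lambda>(a, f1, f2). smul (f1 g * f2 g') a)"
    have D: "f (g \<otimes>\<^bsub>G\<^esub> g') = (\<Sum>(f1, f2)\<leftarrow>D f. f1 g * f2 g')" if "(a, f) \<in> set xs" for a f
    proof -
      have f: "f \<in> ?H" "set (D f) \<subseteq> ?H \<times> ?H" "comult G f = HH_sum G (D f)"
        using bspec[OF DR that] subsetD[OF xs that] by simp_all
      show ?thesis
        using f(3) g unfolding comult_eq_iff[OF f(1,2)] by blast
    qed
    have R: "act g a = evaluate smul (R a) g" if "(a, f) \<in> set xs" for a f
    proof -
      have "set (R a) \<subseteq> UNIV \<times> ?H" "AH_sum smul G (R a) = coaction smul G act a"
        using bspec[OF DR that] by simp_all
      then show ?thesis using coaction_eq_iff[of "R a" a] g(1) by blast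
    qed
    have scale_sum: "smul (\<Sum>y\<leftarrow>ys. k y) a = (\<Sum>y\<leftarrow>ys. smul (k y) a)"
      for k and a and ys :: "(('k ^ 'n \<Rightarrow> 'k) \<times> ('k ^ 'n \<Rightarrow> 'k)) list"
      by (induction ys) (auto simp: scale_left_distrib)
    have "(\<Sum>x\<leftarrow>[(a, f1, f2). (a, f) \<leftarrow> ys, (f1, f2) \<leftarrow> D f]. val x)
        = (\<Sum>(a, f)\<leftarrow>ys. smul (f (g \<otimes>\<^bsub>G\<^esub> g')) a)" if "set ys \<subseteq> set xs" for ys
      using that
    proof (induction ys)
      case (Cons p ys)
      then show ?case
        by (cases p) (auto simp: D val_def scale_sum case_prod_unfold o_def)
    qed simp
    then have lhs: "(\<Sum>x\<leftarrow>[(a, f1, f2). (a, f) \<leftarrow> xs, (f1, f2) \<leftarrow> D f]. val x) = ?F (g \<otimes>\<^bsub>G\<^esub> g')"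
      by (simp add: evaluate_def)
    have m: "smul (c * d * e) (a * b) = smul c a * (smul e (smul d b))" for c d e a b
      by (metis scale_mult_left scale_scale mult.commute mult.left_commute)
    have inner1: "(\<Sum>x\<leftarrow>[(a * b0, f * b1, h). (b0, b1) \<leftarrow> rs]. val x)
        = smul (f g) a * smul (h g') (evaluate smul rs g)" for a f h rs
      by (induction rs) (auto simp: val_def evaluate_def m scale_right_distrib distrib_left)
    have inner2: "(\<Sum>x\<leftarrow>[(a * b0, f * b1, h). (b, h) \<leftarrow> ys, (b0, b1) \<leftarrow> R b]. val x)
        = smul (f g) a * (\<Sum>(b, h)\<leftarrow>ys. smul (h g') (act g b))" if "set ys \<subseteq> set xs" for a f ys
      using that
    proof (induction ys)
      case (Cons p ys)
      obtain b h where p: "p = (b, h)" by (cases p)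
      have "set ys \<subseteq> set xs" and "act g b = evaluate smul (R b) g"
        using Cons.prems R[of b h] by (simp_all add: p)
      then show ?case
        by (simp only: p list.map concat.simps map_append sum_list_append prod.case
            inner1 sum_list.Cons distrib_left Cons.IH)
    qed simp
    have "(\<Sum>x\<leftarrow>[(a * b0, f * b1, h). (a, f) \<leftarrow> ys, (b, h) \<leftarrow> xs, (b0, b1) \<leftarrow> R b]. val x)
        = evaluate smul ys g * act g (?F g')" for ys
      unfolding act_evaluate[OF g(1)]
    proof (induction ys)
      case (Cons p ys)
      obtain a f where p: "p = (a, f)" by (cases p)
      show ?case
        unfolding evaluate_def
        by (simp only: p list.map concat.simps map_append sum_list_append prod.case
            inner2[OF order_refl] sum_list.Cons distrib_right Cons.IH[unfolded evaluate_def])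
    qed (simp add: evaluate_def)
    moreover have "(\<Sum>x\<leftarrow>[(a, f1, f2). (a, f) \<leftarrow> xs, (f1, f2) \<leftarrow> D f]. val x) =
        (\<Sum>x\<leftarrow>[(a * b0, f * b1, h). (a, f) \<leftarrow> xs, (b, h) \<leftarrow> xs, (b0, b1) \<leftarrow> R b]. val x)"
      by (rule tensor3_sum_eq_imp[OF vector_space_axioms subspace_UNIV fun_scale_vector_space
            subspace_coordinate_ring fun_scale_vector_space subspace_coordinate_ring eq])
        (auto simp: val_def fun_scale_def scale_right_distrib scale_left_distrib algebra_simps)
    ultimately show ?thesis using lhs by simp
  qed
  moreover have "?F \<one>\<^bsub>G\<^esub> = 1" using one by (simp add: evaluate_def counit_def)
  ultimately show thesis using that xs t by blast
qed

text \<open>For a cocycle \<open>F\<close> the element \<open>g.F(g\<^sup>-\<^sup>1)\<close> is inverse to \<open>F(g)\<close>, because \<open>F(gg\<^sup>-\<^sup>1) = 1\<close>. So the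
  inverse of a regular cocycle is again a regular map from \<open>G\<close> to \<open>A\<close>.\<close>

lemma twisted_inverse_representable:
  assumes "set xs \<subseteq> UNIV \<times> coordinate_ring (carrier G)"
  shows "\<exists>ys. set ys \<subseteq> UNIV \<times> coordinate_ring (carrier G) \<and>
    (\<forall>g\<in>carrier G. evaluate smul ys g = act g (evaluate smul xs (inv\<^bsub>G\<^esub> g)))"
  using assms
proof (induction xs)
  case Nil
  then show ?case by (intro exI[of _ "[]"]) (auto simp: evaluate_def act_zero)
next
  case (Cons p xs)
  let ?H = "coordinate_ring (carrier G)"
  obtain a f where p: "p = (a, f)" "f \<in> ?H" using Cons.prems by (cases p) auto
  obtain ys where ys: "set ys \<subseteq> UNIV \<times> ?H"
    "\<forall>g\<in>carrier G. evaluate smul ys g = act g (evaluate smul xs (inv\<^bsub>G\<^esub> g))"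
    using Cons by auto
  obtain rs where rs: "set rs \<subseteq> UNIV \<times> ?H" "\<forall>g\<in>carrier G. act g a = evaluate smul rs g"
    using coaction_representable by blast
  define f' where "f' = (\<lambda>g. if g \<in> carrier G then f (inv\<^bsub>G\<^esub> g) else 0)"
  define zs where "zs = map (\<lambda>(b, h). (b, f' * h)) rs"
  have "set zs \<subseteq> UNIV \<times> ?H"
    using rs(1) coordinate_ring_mult[OF coordinate_ring_inv[OF p(2)]] by (auto simp: zs_def f'_def)
  moreover have "evaluate smul zs g = smul (f (inv\<^bsub>G\<^esub> g)) (act g a)" if "g \<in> carrier G" for g
  proof -
    have "evaluate smul zs g = smul (f' g) (evaluate smul rs g)"
      unfolding zs_def by (induction rs) (auto simp: evaluate_def scale_right_distrib)
    then show ?thesis using rs(2) that by (simp add: f'_def)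
  qed
  ultimately show ?case
    using ys
    by (intro exI[of _ "zs @ ys"]) (auto simp: p evaluate_def act_add act_scale)
qed

lemma character_in_coring_grouplikes:
  assumes "\<phi> \<in> hopf_grouplikes G"
  shows "AH_sum smul G [(1, \<phi>)] \<in> coring_grouplikes smul G act"
proof -
  let ?H = "coordinate_ring (carrier G)"
  let ?u = "\<lambda>x. if x \<in> carrier G then 1 else 0 :: 'k"
  have \<phi>: "\<phi> \<in> ?H" "comult G \<phi> = HH_sum G [(\<phi>, \<phi>)]" "counit G \<phi> = 1"
    using assms by (auto simp: hopf_grouplikes_def)
  interpret AH: tensor_with_functions smul UNIV ?H "carrier G" by (rule tensor_AH)
  have "AH_sum smul G [(1, ?u)] = coaction smul G act 1"
    by (subst coaction_eq_iff) (auto simp: evaluate_def act_one coordinate_ring_const)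
  moreover have "\<phi> * ?u = \<phi>"
    using coordinate_ring_outside[OF \<phi>(1)] by (auto simp: fun_eq_iff)
  moreover have "AH_sum smul G [(1, \<phi>)] \<in> carrier (AH smul G)"
    using AH.tensor2_sum_in_carrier[of "[(1, \<phi>)]"] \<phi>(1) by auto
  ultimately show ?thesis
    unfolding coring_grouplikes_def using \<phi> coordinate_ring_const[of "carrier G" 1]
    by (intro CollectI conjI exI[of _ "[(1, \<phi>)]"] exI[of _ "\<lambda>_. [(\<phi>, \<phi>)]"] exI[of _ "\<lambda>_. [(1, ?u)]"])
      auto
qed

end

text \<open>A cocycle takes values in the units of \<open>A\<close>, with regular inverse, and \<open>F(1) = 1\<close>; so it takes
  values in \<open>k\<close>. There \<open>G\<close> acts trivially, and the cocycle identity says that \<open>F\<close> is a character.\<close>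

lemma coring_grouplike_is_character:
  fixes smul :: "'k::alg_closed_field \<Rightarrow> 'a::idom \<Rightarrow> 'a"
  assumes "rational_action smul G act" and conn: "connected_space (zariski_topology (carrier G))"
    and "t \<in> coring_grouplikes smul G act"
  shows "\<exists>\<phi>\<in>hopf_grouplikes G. t = AH_sum smul G [(1, \<phi>)]"
proof -
  interpret rational_action smul G act by fact
  let ?H = "coordinate_ring (carrier G)"
  obtain xs where xs: "set xs \<subseteq> UNIV \<times> ?H" and t: "t = AH_sum smul G xs"
    and F1: "evaluate smul xs \<one>\<^bsub>G\<^esub> = 1"
    and cocycle: "\<And>g h. g \<in> carrier G \<Longrightarrow> h \<in> carrier G \<Longrightarrow>
       evaluate smul xs (g \<otimes>\<^bsub>G\<^esub> h) = evaluate smul xs g * act g (evaluate smul xs h)"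
    using coring_grouplikes_cocycle[OF assms(3)] by blast
  let ?F = "evaluate smul xs"
  obtain ys where ys: "set ys \<subseteq> UNIV \<times> ?H"
    "\<forall>g\<in>carrier G. evaluate smul ys g = act g (?F (inv\<^bsub>G\<^esub> g))"
    using twisted_inverse_representable[OF xs] by blast
  have "?F g * evaluate smul ys g = 1" if "g \<in> carrier G" for g
    using cocycle[OF that inv_closed[OF that]] ys(2) that F1 by simp
  then have const: "?F g \<in> range (\<lambda>c. smul c 1)" if "g \<in> carrier G" for g
    using regular_units_constant[OF k_algebra_axioms conn xs ys(1) _ one_closed F1 that] by blast
  obtain l where l: "Vector_Spaces.linear smul (*) l" "l 1 = (1::'k)"
    using linear_functional_separating[OF vector_space_axioms subspace_single_0, of 1] by auto
  \<comment> \<open>A linear functional with \<open>l(1) = 1\<close> reads off the scalar and shows that it depends regularly on \<open>g\<close>.\<close>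
  define \<phi> where "\<phi> g = l (?F g)" for g
  have \<phi>: "\<phi> \<in> ?H"
    unfolding \<phi>_def by (rule linear_evaluate_regular[OF l(1) xs])
  interpret l: Vector_Spaces.linear smul "(*)" l by fact
  have F: "?F g = smul (\<phi> g) 1" if "g \<in> carrier G" for g
    using const[OF that] l(2) by (auto simp: \<phi>_def l.scale)
  have \<phi>1: "\<phi> \<one>\<^bsub>G\<^esub> = 1" by (simp add: \<phi>_def F1 l(2))
  have "\<phi> (g \<otimes>\<^bsub>G\<^esub> h) = \<phi> g * \<phi> h" if "g \<in> carrier G" "h \<in> carrier G" for g h
    unfolding \<phi>_def cocycle[OF that]
    using that by (simp add: F act_scale act_one scale_mult_left l.scale l(2))
  then have "\<phi> \<in> hopf_grouplikes G" using \<phi> \<phi>1 by (simp add: hopf_grouplikes_iff)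
  moreover have "t = AH_sum smul G [(1, \<phi>)]"
    unfolding t using xs \<phi> F by (subst AH_sum_eq_iff) (auto simp: evaluate_def)
  ultimately show ?thesis by blast
qed

theorem proposition4p1:
  fixes smul :: "'k::alg_closed_field \<Rightarrow> 'a::idom \<Rightarrow> 'a"
    and G :: "('k ^ 'n) monoid"
    and act :: "'k ^ 'n \<Rightarrow> 'a \<Rightarrow> 'a"
  assumes "k_algebra smul"
    and "finitely_generated_algebra smul"
    and "normal_domain TYPE('a)"
    and "affine_algebraic_group G"
    and "connected_space (zariski_topology (carrier G))"
    and "rational_action smul G act"
  shows "hopf_grouplikes G = characters G \<and>
    coring_grouplikes smul G act =
      {AH_sum smul G [(1, \<phi>)] | \<phi>. \<phi> \<in> hopf_grouplikes G}"
proof (intro conjI equalityI subsetI)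
  show "t \<in> {AH_sum smul G [(1, \<phi>)] | \<phi>. \<phi> \<in> hopf_grouplikes G}"
    if "t \<in> coring_grouplikes smul G act" for t
    using coring_grouplike_is_character[OF assms(6,5) that] by blast
next
  interpret rational_action smul G act by fact
  show "t \<in> coring_grouplikes smul G act"
    if "t \<in> {AH_sum smul G [(1, \<phi>)] | \<phi>. \<phi> \<in> hopf_grouplikes G}" for t
    using character_in_coring_grouplikes that by blast
qed (use affine_algebraic_group.hopf_grouplikes_eq_characters[OF assms(4)] in blast)+

end
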